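(* Let $(\Omega,\Sigma,\mu)$ be a measure space and let $K$ be a compact Hausdorff totally disconnected space. Then $$\mathrm{NA}_\pi(L_1(\mu)\widehat{\otimes}_\pi C(K))=L_1(\mu)\widehat{\otimes}_\pi C(K).$$
   Context: All Banach spaces are real; $C(K)$ is the space of real-valued continuous functions on $K$ with the supremum norm. A topological space is totally disconnected if its only non-empty connected subsets are singletons. $X\widehat{\otimes}_\pi Y$ denotes the projective tensor product. An element $u\in X\widehat{\otimes}_\pi Y$ attains its projective norm if there are $(x_i)\subseteq X$, $(y_i)\subseteq Y$ with $u=\sum_{i=1}^\infty x_i\otimes y_i$ and $\|u\|_\pi=\sum_{i=1}^\infty\|x_i\|\|y_i\|$; $\mathrm{NA}_\pi(X\widehat{\otimes}_\pi Y)$ is the set of such elements. *)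

theory Defs
  imports "HOL-Analysis.Analysis"
begin

section \<open>Real normed spaces with an explicit carrier\<close>

text \<open>
  Carriers are explicit sets because \<open>L\<^sub>1(\<mu>)\<close> depends on the value \<open>\<mu>\<close> and so cannot be a type.
\<close>

record 'a nspace =
  vecs :: "'a set"
  vadd :: "'a \<Rightarrow> 'a \<Rightarrow> 'a"
  vzero :: 'a
  vscale :: "real \<Rightarrow> 'a \<Rightarrow> 'a"
  vnorm :: "'a \<Rightarrow> real"

definition vdist :: "'a nspace \<Rightarrow> 'a \<Rightarrow> 'a \<Rightarrow> real" where
  "vdist V u v = vnorm V (vadd V u (vscale V (- 1) v))"

primrec partial_sum :: "'a nspace \<Rightarrow> (nat \<Rightarrow> 'a) \<Rightarrow> nat \<Rightarrow> 'a" where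
  "partial_sum V f 0 = vzero V"
| "partial_sum V f (Suc n) = vadd V (partial_sum V f n) (f n)"

definition series_sums :: "'a nspace \<Rightarrow> (nat \<Rightarrow> 'a) \<Rightarrow> 'a \<Rightarrow> bool" where
  "series_sums V f u \<longleftrightarrow> (\<lambda>n. vdist V (partial_sum V f n) u) \<longlonglongrightarrow> 0"


section \<open>Completion: Cauchy sequences modulo null sequences\<close>

definition cauchy_seqs :: "'a nspace \<Rightarrow> (nat \<Rightarrow> 'a) set" where
  "cauchy_seqs V = {s. range s \<subseteq> vecs V \<and>
     (\<forall>e>0. \<exists>N. \<forall>m\<ge>N. \<forall>n\<ge>N. vdist V (s m) (s n) < e)}"

definition null_rel :: "'a nspace \<Rightarrow> ((nat \<Rightarrow> 'a) \<times> (nat \<Rightarrow> 'a)) set" where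
  "null_rel V = {(s, t). s \<in> cauchy_seqs V \<and> t \<in> cauchy_seqs V \<and>
     (\<lambda>n. vdist V (s n) (t n)) \<longlonglongrightarrow> 0}"

definition completion :: "'a nspace \<Rightarrow> (nat \<Rightarrow> 'a) set nspace" where
  "completion V =
     \<lparr> vecs = cauchy_seqs V // null_rel V,
       vadd = (\<lambda>A B. \<Union>s\<in>A. \<Union>t\<in>B. null_rel V `` {\<lambda>n. vadd V (s n) (t n)}),
       vzero = null_rel V `` {\<lambda>_. vzero V},
       vscale = (\<lambda>c A. \<Union>s\<in>A. null_rel V `` {\<lambda>n. vscale V c (s n)}),
       vnorm = (\<lambda>A. the_elem ((\<lambda>s. lim (\<lambda>n. vnorm V (s n))) ` A)) \<rparr>"

definition completion_embed :: "'a nspace \<Rightarrow> 'a \<Rightarrow> (nat \<Rightarrow> 'a) set" where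
  "completion_embed V v = null_rel V `` {\<lambda>_. v}"


section \<open>The projective tensor product\<close>

definition bilinear_form :: "'a nspace \<Rightarrow> 'b nspace \<Rightarrow> ('a \<Rightarrow> 'b \<Rightarrow> real) \<Rightarrow> bool" where
  "bilinear_form X Y B \<longleftrightarrow>
     (\<forall>x\<in>vecs X. \<forall>x'\<in>vecs X. \<forall>y\<in>vecs Y. B (vadd X x x') y = B x y + B x' y) \<and>
     (\<forall>c. \<forall>x\<in>vecs X. \<forall>y\<in>vecs Y. B (vscale X c x) y = c * B x y) \<and>
     (\<forall>x\<in>vecs X. \<forall>y\<in>vecs Y. \<forall>y'\<in>vecs Y. B x (vadd Y y y') = B x y + B x y') \<and>
     (\<forall>c. \<forall>x\<in>vecs X. \<forall>y\<in>vecs Y. B x (vscale Y c y) = c * B x y)"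

text \<open>
  The algebraic tensor product is realized, as in Ryan's \<^emph>\<open>Introduction to Tensor Products of Banach
  Spaces\<close>, as a space of linear functionals on the space of all (not necessarily bounded) bilinear
  forms, with \<open>x \<otimes> y\<close> acting by evaluation at \<open>(x, y)\<close>.  Functionals are set to 0 off the bilinear
  forms, so that equality and the vector operations are those of functions.
\<close>

type_synonym ('a, 'b) tensor = "('a \<Rightarrow> 'b \<Rightarrow> real) \<Rightarrow> real"

definition pure_tensor :: "'a nspace \<Rightarrow> 'b nspace \<Rightarrow> 'a \<Rightarrow> 'b \<Rightarrow> ('a, 'b) tensor" where
  "pure_tensor X Y x y = (\<lambda>B. if bilinear_form X Y B then B x y else 0)"

definition tensor_of :: "'a nspace \<Rightarrow> 'b nspace \<Rightarrow> ('a \<times> 'b) list \<Rightarrow> ('a, 'b) tensor" where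
  "tensor_of X Y zs = (\<lambda>B. \<Sum>(x, y)\<leftarrow>zs. pure_tensor X Y x y B)"

definition alg_tensor :: "'a nspace \<Rightarrow> 'b nspace \<Rightarrow> ('a, 'b) tensor nspace" where
  "alg_tensor X Y =
     \<lparr> vecs = {tensor_of X Y zs | zs. set zs \<subseteq> vecs X \<times> vecs Y},
       vadd = (\<lambda>u v B. u B + v B),
       vzero = (\<lambda>B. 0),
       vscale = (\<lambda>c u B. c * u B),
       vnorm = (\<lambda>u. Inf {(\<Sum>(x, y)\<leftarrow>zs. vnorm X x * vnorm Y y) | zs.
                           set zs \<subseteq> vecs X \<times> vecs Y \<and> u = tensor_of X Y zs}) \<rparr>"

definition proj_tensor :: "'a nspace \<Rightarrow> 'b nspace \<Rightarrow> (nat \<Rightarrow> ('a, 'b) tensor) set nspace" where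
  "proj_tensor X Y = completion (alg_tensor X Y)"

definition elem_tensor :: "'a nspace \<Rightarrow> 'b nspace \<Rightarrow> 'a \<Rightarrow> 'b \<Rightarrow> (nat \<Rightarrow> ('a, 'b) tensor) set" where
  "elem_tensor X Y x y = completion_embed (alg_tensor X Y) (pure_tensor X Y x y)"

definition attains_proj_norm ::
    "'a nspace \<Rightarrow> 'b nspace \<Rightarrow> (nat \<Rightarrow> ('a, 'b) tensor) set \<Rightarrow> bool" where
  "attains_proj_norm X Y u \<longleftrightarrow>
     (\<exists>x y. (\<forall>i. x i \<in> vecs X) \<and> (\<forall>i. y i \<in> vecs Y) \<and>
        series_sums (proj_tensor X Y) (\<lambda>i. elem_tensor X Y (x i) (y i)) u \<and>
        (\<lambda>i. vnorm X (x i) * vnorm Y (y i)) sums vnorm (proj_tensor X Y) u)"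

definition NA_proj :: "'a nspace \<Rightarrow> 'b nspace \<Rightarrow> (nat \<Rightarrow> ('a, 'b) tensor) set set" where
  "NA_proj X Y = {u \<in> vecs (proj_tensor X Y). attains_proj_norm X Y u}"


section \<open>The spaces \<open>L\<^sub>1(\<mu>)\<close> and \<open>C(K)\<close>\<close>

definition ae_rel :: "'a measure \<Rightarrow> (('a \<Rightarrow> real) \<times> ('a \<Rightarrow> real)) set" where
  "ae_rel M = {(f, g). integrable M f \<and> integrable M g \<and> (AE x in M. f x = g x)}"

definition L1_space :: "'a measure \<Rightarrow> ('a \<Rightarrow> real) set nspace" where
  "L1_space M =
     \<lparr> vecs = {f. integrable M f} // ae_rel M,
       vadd = (\<lambda>A B. \<Union>f\<in>A. \<Union>g\<in>B. ae_rel M `` {\<lambda>x. f x + g x}),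
       vzero = ae_rel M `` {\<lambda>_. 0},
       vscale = (\<lambda>c A. \<Union>f\<in>A. ae_rel M `` {\<lambda>x. c * f x}),
       vnorm = (\<lambda>A. the_elem ((\<lambda>f. \<integral>x. \<bar>f x\<bar> \<partial>M) ` A)) \<rparr>"

text \<open>
  The \<open>0\<close> inserted in the supremum only matters for the empty space, where it makes the norm of the
  unique function \<open>0\<close>.
\<close>

definition C_space :: "'k topology \<Rightarrow> ('k \<Rightarrow> real) nspace" where
  "C_space K =
     \<lparr> vecs = {f \<in> extensional (topspace K). continuous_map K euclideanreal f},
       vadd = (\<lambda>f g. \<lambda>x\<in>topspace K. f x + g x),
       vzero = (\<lambda>x\<in>topspace K. 0),
       vscale = (\<lambda>c f. \<lambda>x\<in>topspace K. c * f x),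
       vnorm = (\<lambda>f. Sup (insert 0 ((\<lambda>x. \<bar>f x\<bar>) ` topspace K))) \<rparr>"

definition totally_disconnected_space :: "'k topology \<Rightarrow> bool" where
  "totally_disconnected_space K \<longleftrightarrow>
     (\<forall>S. connectedin K S \<and> S \<noteq> {} \<longrightarrow> (\<exists>x. S = {x}))"

end

theory Submission
  imports Defs "HOL-Library.Function_Algebras"
begin

text \<open>
  On simple functions \<open>F : \<Omega> \<rightarrow> C(K)\<close> the projective norm is \<open>\<integral> \<parallel>F(\<omega>)\<parallel>\<close>; the lower bound comes from the
  bilinear form that evaluates at points where the values of \<open>F\<close> attain their norms.  Let \<open>u\<close> be the
  limit of tensors given by simple functions \<open>F\<^sub>n\<close> and let \<open>N(\<omega>) = \<parallel>F\<^sub>0(\<omega>)\<parallel>\<close>.  Because \<open>K\<close> has a base of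
  clopen sets, there is a continuous function \<open>e\<^sub>\<omega>\<close> with values \<open>\<plusminus>1\<close> that agrees with the sign of \<open>F\<^sub>0(\<omega>)\<close>
  wherever \<open>\<bar>F\<^sub>0(\<omega>)\<bar> \<ge> N(\<omega>)/5\<close>.  Then \<open>G(\<omega>) = N(\<omega>)/5 e\<^sub>\<omega>\<close> satisfies
  \<open>\<parallel>F\<^sub>n(\<omega>) - G(\<omega>)\<parallel> \<le> \<parallel>F\<^sub>n(\<omega>)\<parallel> - \<parallel>G(\<omega>)\<parallel>\<close> wherever all \<open>F\<^sub>n(\<omega>)\<close> stay within \<open>N(\<omega>)/5\<close> of \<open>F\<^sub>0(\<omega>)\<close>.  If the
  \<open>F\<^sub>n\<close> converge fast, this happens on most of the mass of \<open>N\<close>, so putting \<open>G = 0\<close> elsewhere splits off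
  from \<open>u\<close> a finite sum \<open>v\<close> of elementary tensors with \<open>\<parallel>u - v\<parallel> = \<parallel>u\<parallel> - \<parallel>v\<parallel>\<close> and \<open>\<parallel>v\<parallel> \<ge> \<parallel>u\<parallel>/10\<close>.
  Iterating gives a representation of \<open>u\<close> that attains its norm.
\<close>

section \<open>Completions of seminormed spaces of functions\<close>

text \<open>A seminorm suffices: Cauchy sequences modulo null sequences already identify vectors at
  distance zero. Vectors are functions, so the group laws come from pointwise arithmetic.\<close>

locale function_seminorm =
  fixes V :: "('b \<Rightarrow> real) nspace"
  assumes vadd_eq: "vadd V = (+)"
    and vzero_eq: "vzero V = 0"
    and vscale_eq: "vscale V = (\<lambda>c u b. c * u b)"
    and zero_mem: "0 \<in> vecs V"
    and add_mem: "\<lbrakk>u \<in> vecs V; v \<in> vecs V\<rbrakk> \<Longrightarrow> u + v \<in> vecs V"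
    and scale_mem: "u \<in> vecs V \<Longrightarrow> (\<lambda>b. c * u b) \<in> vecs V"
    and norm_triangle: "\<lbrakk>u \<in> vecs V; v \<in> vecs V\<rbrakk> \<Longrightarrow> vnorm V (u + v) \<le> vnorm V u + vnorm V v"
    and norm_scale: "u \<in> vecs V \<Longrightarrow> vnorm V (\<lambda>b. c * u b) = \<bar>c\<bar> * vnorm V u"
begin

lemma minus_mem: "u \<in> vecs V \<Longrightarrow> - u \<in> vecs V"
  using scale_mem[of u "-1"] by (simp add: fun_Compl_def)

lemma norm_minus: "u \<in> vecs V \<Longrightarrow> vnorm V (- u) = vnorm V u"
  using norm_scale[of u "-1"] by (simp add: fun_Compl_def)

lemma diff_mem: "\<lbrakk>u \<in> vecs V; v \<in> vecs V\<rbrakk> \<Longrightarrow> u - v \<in> vecs V"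
  using add_mem[of u "- v"] minus_mem[of v] by simp

lemma sum_mem: "(\<And>i. i \<in> I \<Longrightarrow> t i \<in> vecs V) \<Longrightarrow> sum t I \<in> vecs V"
  by (induction I rule: infinite_finite_induct) (auto simp: zero_mem add_mem)

lemma norm_zero: "vnorm V 0 = 0"
  using norm_scale[OF zero_mem, of 0] by (simp add: zero_fun_def)

lemma norm_diff_commute: "\<lbrakk>u \<in> vecs V; v \<in> vecs V\<rbrakk> \<Longrightarrow> vnorm V (u - v) = vnorm V (v - u)"
  using norm_minus[of "u - v"] diff_mem[of u v] by simp

lemma norm_nonneg: "u \<in> vecs V \<Longrightarrow> 0 \<le> vnorm V u"
  using norm_triangle[of u "- u"] minus_mem[of u] norm_minus[of u] by (simp add: norm_zero)

lemma norm_triangle_sub: "\<lbrakk>u \<in> vecs V; v \<in> vecs V\<rbrakk> \<Longrightarrow> vnorm V u \<le> vnorm V (u - v) + vnorm V v"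
  using norm_triangle[of "u - v" v] diff_mem[of u v] by simp

lemma norm_triangle_diff:
  "\<lbrakk>u \<in> vecs V; v \<in> vecs V; w \<in> vecs V\<rbrakk> \<Longrightarrow> vnorm V (u - w) \<le> vnorm V (u - v) + vnorm V (v - w)"
  using norm_triangle[of "u - v" "v - w"] diff_mem[of u v] diff_mem[of v w] by simp

lemma abs_norm_diff_le:
  "\<lbrakk>u \<in> vecs V; v \<in> vecs V\<rbrakk> \<Longrightarrow> \<bar>vnorm V u - vnorm V v\<bar> \<le> vnorm V (u - v)"
  using norm_triangle_sub[of u v] norm_triangle_sub[of v u] norm_diff_commute[of u v] by simp

lemma vdist_eq: "vdist V u v = vnorm V (u - v)"
proof -
  have "u + (\<lambda>b. - 1 * v b) = u - v"
    by (auto simp: fun_eq_iff)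
  then show ?thesis
    by (simp add: vdist_def vadd_eq vscale_eq)
qed

lemma cauchy_seqs_iff:
  "s \<in> cauchy_seqs V \<longleftrightarrow>
     (\<forall>n. s n \<in> vecs V) \<and> (\<forall>e>0. \<exists>N. \<forall>m\<ge>N. \<forall>n\<ge>N. vnorm V (s m - s n) < e)"
  by (auto simp: cauchy_seqs_def vdist_eq)

lemma cauchy_memD: "s \<in> cauchy_seqs V \<Longrightarrow> s n \<in> vecs V"
  by (auto simp: cauchy_seqs_iff)

lemma null_rel_iff:
  "(s, t) \<in> null_rel V \<longleftrightarrow>
     s \<in> cauchy_seqs V \<and> t \<in> cauchy_seqs V \<and> (\<lambda>n. vnorm V (s n - t n)) \<longlonglongrightarrow> 0"
  by (auto simp: null_rel_def vdist_eq)

lemma cauchy_const: "u \<in> vecs V \<Longrightarrow> (\<lambda>_. u) \<in> cauchy_seqs V"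
  by (auto simp: cauchy_seqs_iff norm_zero)

lemma cauchy_add:
  assumes s: "s \<in> cauchy_seqs V" and t: "t \<in> cauchy_seqs V"
  shows "(\<lambda>n. s n + t n) \<in> cauchy_seqs V"
  unfolding cauchy_seqs_iff
proof (intro conjI allI impI)
  show "s n + t n \<in> vecs V" for n
    using s t by (auto intro: add_mem cauchy_memD)
next
  fix e :: real
  assume "e > 0"
  then have "e / 2 > 0"
    by simp
  then obtain N1 N2 where
      N1: "\<And>m n. \<lbrakk>m \<ge> N1; n \<ge> N1\<rbrakk> \<Longrightarrow> vnorm V (s m - s n) < e / 2"
    and N2: "\<And>m n. \<lbrakk>m \<ge> N2; n \<ge> N2\<rbrakk> \<Longrightarrow> vnorm V (t m - t n) < e / 2"
    using s t unfolding cauchy_seqs_iff by meson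
  have "vnorm V ((s m + t m) - (s n + t n)) < e" if "m \<ge> max N1 N2" "n \<ge> max N1 N2" for m n
  proof -
    have "(s m + t m) - (s n + t n) = (s m - s n) + (t m - t n)"
      by simp
    moreover have "vnorm V ((s m - s n) + (t m - t n)) \<le> vnorm V (s m - s n) + vnorm V (t m - t n)"
      using s t by (intro norm_triangle diff_mem cauchy_memD)
    ultimately have "vnorm V ((s m + t m) - (s n + t n)) \<le> vnorm V (s m - s n) + vnorm V (t m - t n)"
      by (simp only:)
    then show ?thesis
      using N1[of m n] N2[of m n] that by simp
  qed
  then show "\<exists>N. \<forall>m\<ge>N. \<forall>n\<ge>N. vnorm V ((s m + t m) - (s n + t n)) < e"
    by blast
qed

lemma cauchy_minus: "s \<in> cauchy_seqs V \<Longrightarrow> (\<lambda>n. - s n) \<in> cauchy_seqs V"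
proof -
  assume s: "s \<in> cauchy_seqs V"
  have "vnorm V (- s m - - s n) = vnorm V (s m - s n)" for m n
    using norm_diff_commute[of "s m" "s n"] cauchy_memD[OF s] by (simp add: algebra_simps)
  then show ?thesis
    using s by (simp add: cauchy_seqs_iff minus_mem)
qed

lemma cauchy_diff:
  "\<lbrakk>s \<in> cauchy_seqs V; t \<in> cauchy_seqs V\<rbrakk> \<Longrightarrow> (\<lambda>n. s n - t n) \<in> cauchy_seqs V"
  using cauchy_add[of s "\<lambda>n. - t n"] cauchy_minus[of t] by simp

lemma cauchy_diff_const:
  "\<lbrakk>s \<in> cauchy_seqs V; u \<in> vecs V\<rbrakk> \<Longrightarrow> (\<lambda>n. s n - u) \<in> cauchy_seqs V"
  by (intro cauchy_diff cauchy_const)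

lemma cauchy_norm_tendsto:
  assumes s: "s \<in> cauchy_seqs V"
  shows "(\<lambda>n. vnorm V (s n)) \<longlonglongrightarrow> lim (\<lambda>n. vnorm V (s n))"
proof -
  have "Cauchy (\<lambda>n. vnorm V (s n))"
  proof (rule metric_CauchyI)
    fix e :: real
    assume "e > 0"
    then obtain N where N: "\<forall>m\<ge>N. \<forall>n\<ge>N. vnorm V (s m - s n) < e"
      using s unfolding cauchy_seqs_iff by meson
    have "dist (vnorm V (s m)) (vnorm V (s n)) < e" if "m \<ge> N" "n \<ge> N" for m n
      unfolding dist_real_def
      using abs_norm_diff_le[OF cauchy_memD[OF s, of m] cauchy_memD[OF s, of n]] N that
      by (meson le_less_trans)
    then show "\<exists>N. \<forall>m\<ge>N. \<forall>n\<ge>N. dist (vnorm V (s m)) (vnorm V (s n)) < e"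
      by blast
  qed
  then show ?thesis
    by (simp add: Cauchy_convergent_iff convergent_LIMSEQ_iff)
qed

lemma equiv_null_rel: "equiv (cauchy_seqs V) (null_rel V)"
proof (rule equivI)
  show "null_rel V \<subseteq> cauchy_seqs V \<times> cauchy_seqs V"
    by (auto simp: null_rel_iff)
  show "refl_on (cauchy_seqs V) (null_rel V)"
    by (auto simp: refl_on_def null_rel_iff norm_zero)
  show "sym (null_rel V)"
  proof (rule symI)
    fix s t
    assume "(s, t) \<in> null_rel V"
    moreover from this have "vnorm V (s n - t n) = vnorm V (t n - s n)" for n
      by (auto simp: null_rel_iff intro: norm_diff_commute cauchy_memD)
    ultimately show "(t, s) \<in> null_rel V"
      by (simp add: null_rel_iff)
  qed
  show "trans (null_rel V)"
  proof (rule transI)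
    fix r s t
    assume rs: "(r, s) \<in> null_rel V" and st: "(s, t) \<in> null_rel V"
    have lim: "(\<lambda>n. vnorm V (r n - s n) + vnorm V (s n - t n)) \<longlonglongrightarrow> 0 + 0"
      using rs st by (intro tendsto_add) (auto simp: null_rel_iff)
    have mem: "r n \<in> vecs V" "s n \<in> vecs V" "t n \<in> vecs V" for n
      using rs st by (auto simp: null_rel_iff intro: cauchy_memD)
    have "(\<lambda>n. vnorm V (r n - t n)) \<longlonglongrightarrow> 0"
    proof (rule tendsto_sandwich[OF _ _ tendsto_const])
      show "(\<lambda>n. vnorm V (r n - s n) + vnorm V (s n - t n)) \<longlonglongrightarrow> 0"
        using lim by simp
      show "\<forall>\<^sub>F n in sequentially. 0 \<le> vnorm V (r n - t n)"
        by (simp add: norm_nonneg diff_mem mem)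
      show "\<forall>\<^sub>F n in sequentially. vnorm V (r n - t n) \<le> vnorm V (r n - s n) + vnorm V (s n - t n)"
        by (simp add: norm_triangle_diff mem)
    qed
    then show "(r, t) \<in> null_rel V"
      using rs st by (simp add: null_rel_iff)
  qed
qed

section \<open>Operations and norm of the completion, computed on representatives\<close>

lemma class_eq: "(s, t) \<in> null_rel V \<Longrightarrow> null_rel V `` {s} = null_rel V `` {t}"
  by (rule equiv_class_eq[OF equiv_null_rel])

lemma vecs_completionE:
  assumes "u \<in> vecs (completion V)"
  obtains s where "s \<in> cauchy_seqs V" "u = null_rel V `` {s}"
  using assms by (auto simp: completion_def elim: quotientE)

text \<open>Termwise addition respects null differences, so the union over all representatives in
  \<open>completion\<close> collapses to a single class.\<close>

lemma vadd_completion: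
  assumes "s \<in> cauchy_seqs V" "t \<in> cauchy_seqs V"
  shows "vadd (completion V) (null_rel V `` {s}) (null_rel V `` {t}) = null_rel V `` {\<lambda>n. s n + t n}"
proof -
  have "congruent2 (null_rel V) (null_rel V) (\<lambda>s t. null_rel V `` {\<lambda>n. vadd V (s n) (t n)})"
  proof (rule congruent2I')
    fix s s' t t'
    assume s: "(s, s') \<in> null_rel V" and t: "(t, t') \<in> null_rel V"
    have lim: "(\<lambda>n. vnorm V (s n - s' n) + vnorm V (t n - t' n)) \<longlonglongrightarrow> 0 + 0"
      using s t by (intro tendsto_add) (auto simp: null_rel_iff)
    have mem: "s n \<in> vecs V" "s' n \<in> vecs V" "t n \<in> vecs V" "t' n \<in> vecs V" for n
      using s t by (auto simp: null_rel_iff intro: cauchy_memD)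
    have le: "vnorm V ((s n + t n) - (s' n + t' n)) \<le> vnorm V (s n - s' n) + vnorm V (t n - t' n)" for n
    proof -
      have "(s n + t n) - (s' n + t' n) = (s n - s' n) + (t n - t' n)"
        by simp
      moreover have "vnorm V ((s n - s' n) + (t n - t' n)) \<le> vnorm V (s n - s' n) + vnorm V (t n - t' n)"
        by (intro norm_triangle diff_mem mem)
      ultimately show ?thesis
        by (simp only:)
    qed
    have "(\<lambda>n. vnorm V ((s n + t n) - (s' n + t' n))) \<longlonglongrightarrow> 0"
    proof (rule tendsto_sandwich[OF _ _ tendsto_const])
      show "(\<lambda>n. vnorm V (s n - s' n) + vnorm V (t n - t' n)) \<longlonglongrightarrow> 0"
        using lim by simp
      show "\<forall>\<^sub>F n in sequentially. 0 \<le> vnorm V ((s n + t n) - (s' n + t' n))"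
        by (simp add: norm_nonneg diff_mem add_mem mem)
    qed (simp add: le)
    then show "null_rel V `` {\<lambda>n. vadd V (s n) (t n)} = null_rel V `` {\<lambda>n. vadd V (s' n) (t' n)}"
      using s t by (intro class_eq) (auto simp: null_rel_iff vadd_eq cauchy_add)
  qed
  from UN_equiv_class2[OF equiv_null_rel equiv_null_rel this assms] show ?thesis
    by (simp add: completion_def vadd_eq)
qed

text \<open>The scalar -1 is the one that \<open>vdist\<close> applies; together with
  \<open>vadd_completion\<close> this makes distances in the completion computable.\<close>

lemma vscale_completion_minus_one:
  assumes "s \<in> cauchy_seqs V"
  shows "vscale (completion V) (- 1) (null_rel V `` {s}) = null_rel V `` {\<lambda>n. - s n}"
proof -
  have minus: "vscale V (- 1) u = - u" for u
    by (simp add: vscale_eq fun_Compl_def)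
  have "congruent (null_rel V) (\<lambda>s. null_rel V `` {\<lambda>n. vscale V (- 1) (s n)})"
  proof (rule congruentI)
    fix s t
    assume st: "(s, t) \<in> null_rel V"
    have "vnorm V (- s n - - t n) = vnorm V (s n - t n)" for n
      using norm_diff_commute[of "s n" "t n"] st
      by (simp add: null_rel_iff cauchy_memD algebra_simps)
    then show "null_rel V `` {\<lambda>n. vscale V (- 1) (s n)} = null_rel V `` {\<lambda>n. vscale V (- 1) (t n)}"
      using st by (intro class_eq) (simp add: null_rel_iff minus cauchy_minus)
  qed
  from UN_equiv_class[OF equiv_null_rel this assms] show ?thesis
    by (simp add: completion_def minus)
qed

text \<open>Seminorms along equivalent sequences differ by at most the seminorm of a null
  difference. Hence all representatives have the same limit, and \<open>the_elem\<close> is applied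
  to a singleton.\<close>

lemma vnorm_completion:
  assumes s: "s \<in> cauchy_seqs V"
  shows "vnorm (completion V) (null_rel V `` {s}) = lim (\<lambda>n. vnorm V (s n))"
proof -
  have "lim (\<lambda>n. vnorm V (t n)) = lim (\<lambda>n. vnorm V (s n))" if "(s, t) \<in> null_rel V" for t
  proof -
    have t: "t \<in> cauchy_seqs V" and st: "(\<lambda>n. vnorm V (s n - t n)) \<longlonglongrightarrow> 0"
      using that by (auto simp: null_rel_iff)
    have "(\<lambda>n. vnorm V (s n) - vnorm V (t n)) \<longlonglongrightarrow> 0"
      by (rule Lim_null_comparison[OF _ st])
         (use s t in \<open>auto intro!: always_eventually abs_norm_diff_le simp: cauchy_memD\<close>)
    from tendsto_diff[OF cauchy_norm_tendsto[OF s] this] show ?thesis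
      by (simp add: limI)
  qed
  then have "(\<lambda>t. lim (\<lambda>n. vnorm V (t n))) ` (null_rel V `` {s}) =
      (\<lambda>_. lim (\<lambda>n. vnorm V (s n))) ` (null_rel V `` {s})"
    by (intro image_cong) (simp_all only: Image_singleton_iff)
  also have "\<dots> = {lim (\<lambda>n. vnorm V (s n))}"
    by (rule image_constant[OF equiv_class_self[OF equiv_null_rel s]])
  finally show ?thesis
    by (simp add: completion_def)
qed

lemma partial_sum_completion_embed:
  assumes t: "\<And>i. t i \<in> vecs V"
  shows "partial_sum (completion V) (\<lambda>i. completion_embed V (t i)) n = completion_embed V (\<Sum>i<n. t i)"
proof (induction n)
  case 0
  show ?case
    by (simp add: completion_def completion_embed_def vzero_eq zero_fun_def)
next
  case (Suc n)
  have "(\<Sum>i<n. t i) \<in> vecs V"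
    by (intro sum_mem t)
  then have "vadd (completion V) (completion_embed V (\<Sum>i<n. t i)) (completion_embed V (t n)) =
      completion_embed V (\<Sum>i<Suc n. t i)"
    unfolding completion_embed_def by (subst vadd_completion[OF cauchy_const cauchy_const[OF t]]) simp_all
  then show ?case
    by (simp only: partial_sum.simps Suc)
qed

text \<open>The distance from an embedded vector to the class of \<open>s\<close> is a limit of
  seminorms in \<open>V\<close>. Convergence of a series in the completion thus becomes an iterated
  limit that is free of equivalence classes.\<close>

lemma series_sums_completion_embed:
  assumes t: "\<And>i. t i \<in> vecs V" and s: "s \<in> cauchy_seqs V"
    and lim: "(\<lambda>n. lim (\<lambda>m. vnorm V (s m - (\<Sum>i<n. t i)))) \<longlonglongrightarrow> 0"
  shows "series_sums (completion V) (\<lambda>i. completion_embed V (t i)) (null_rel V `` {s})"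
proof -
  have "vdist (completion V) (completion_embed V P) (null_rel V `` {s}) = lim (\<lambda>m. vnorm V (s m - P))"
    if P: "P \<in> vecs V" for P
  proof -
    have "vdist (completion V) (completion_embed V P) (null_rel V `` {s}) = lim (\<lambda>m. vnorm V (P + - s m))"
      unfolding vdist_def completion_embed_def
      using P s by (subst vscale_completion_minus_one)
        (auto simp only: vadd_completion vnorm_completion cauchy_const cauchy_minus cauchy_add)
    moreover have "vnorm V (P + - s m) = vnorm V (s m - P)" for m
      using norm_diff_commute[OF P cauchy_memD[OF s, of m]] by simp
    ultimately show ?thesis
      by simp
  qed
  then show ?thesis
    unfolding series_sums_def using lim by (simp add: partial_sum_completion_embed t sum_mem)
qed

end

section \<open>Algebraic tensors\<close>

text \<open>The cost of one finite representation; the projective norm is the infimum of these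
  costs. With lists, tensors are added by concatenation, under which costs add.\<close>

definition tensor_weight :: "'a nspace \<Rightarrow> 'b nspace \<Rightarrow> ('a \<times> 'b) list \<Rightarrow> real" where
  "tensor_weight X Y zs = (\<Sum>(x, y)\<leftarrow>zs. vnorm X x * vnorm Y y)"

lemma tensor_weight_simps [simp]:
  "tensor_weight X Y [] = 0"
  "tensor_weight X Y (z # zs) = vnorm X (fst z) * vnorm Y (snd z) + tensor_weight X Y zs"
  "tensor_weight X Y (zs @ zs') = tensor_weight X Y zs + tensor_weight X Y zs'"
  by (simp_all add: tensor_weight_def case_prod_beta)

lemma tensor_of_Nil: "tensor_of X Y [] = 0"
  by (simp add: tensor_of_def fun_eq_iff)

lemma tensor_of_Cons: "tensor_of X Y (z # zs) = pure_tensor X Y (fst z) (snd z) + tensor_of X Y zs"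
  by (simp add: tensor_of_def fun_eq_iff case_prod_beta)

lemma tensor_of_append: "tensor_of X Y (zs @ zs') = tensor_of X Y zs + tensor_of X Y zs'"
  by (simp add: tensor_of_def fun_eq_iff)

lemma tensor_of_map_upt: "tensor_of X Y (map z [0..<n]) = (\<Sum>i<n. pure_tensor X Y (fst (z i)) (snd (z i)))"
proof (induction n)
  case (Suc n)
  then show ?case
    by (simp only: upt_Suc_append map_append tensor_of_append list.map tensor_of_Cons tensor_of_Nil
        sum.lessThan_Suc) simp
qed (simp add: tensor_of_Nil)

lemma tensor_weight_map_upt:
  "tensor_weight X Y (map z [0..<n]) = (\<Sum>i<n. vnorm X (fst (z i)) * vnorm Y (snd (z i)))"
  by (induction n) simp_all

lemma tensor_of_not_bilinear: "\<not> bilinear_form X Y B \<Longrightarrow> tensor_of X Y zs B = 0"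
  by (induction zs) (simp_all add: tensor_of_Nil tensor_of_Cons pure_tensor_def)

lemma tensor_of_bilinear: "bilinear_form X Y B \<Longrightarrow> tensor_of X Y zs B = (\<Sum>(x, y)\<leftarrow>zs. B x y)"
  by (simp add: tensor_of_def pure_tensor_def)

section \<open>The projective seminorm on the algebraic tensor product\<close>

locale absolutely_homogeneous =
  fixes X :: "'a nspace"
  assumes vzero_mem: "vzero X \<in> vecs X"
    and vscale_mem: "x \<in> vecs X \<Longrightarrow> vscale X c x \<in> vecs X"
    and vnorm_vzero: "vnorm X (vzero X) = 0"
    and vnorm_nonneg: "x \<in> vecs X \<Longrightarrow> 0 \<le> vnorm X x"
    and vnorm_vscale: "x \<in> vecs X \<Longrightarrow> vnorm X (vscale X c x) = \<bar>c\<bar> * vnorm X x"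

locale tensor_factors = X: absolutely_homogeneous X + Y: absolutely_homogeneous Y
  for X :: "'a nspace" and Y :: "'b nspace"
begin

lemma tensor_weight_nonneg: "set zs \<subseteq> vecs X \<times> vecs Y \<Longrightarrow> 0 \<le> tensor_weight X Y zs"
  by (induction zs) (auto simp: X.vnorm_nonneg Y.vnorm_nonneg)

lemma vecs_alg_tensor:
  "u \<in> vecs (alg_tensor X Y) \<longleftrightarrow> (\<exists>zs. set zs \<subseteq> vecs X \<times> vecs Y \<and> u = tensor_of X Y zs)"
  by (auto simp: alg_tensor_def)

lemma tensor_of_mem: "set zs \<subseteq> vecs X \<times> vecs Y \<Longrightarrow> tensor_of X Y zs \<in> vecs (alg_tensor X Y)"
  by (auto simp: vecs_alg_tensor)

lemma vnorm_alg_tensor: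
  "vnorm (alg_tensor X Y) u =
     Inf {tensor_weight X Y zs | zs. set zs \<subseteq> vecs X \<times> vecs Y \<and> u = tensor_of X Y zs}"
  by (simp add: alg_tensor_def tensor_weight_def)

lemma norm_tensor_of_le:
  "set zs \<subseteq> vecs X \<times> vecs Y \<Longrightarrow> vnorm (alg_tensor X Y) (tensor_of X Y zs) \<le> tensor_weight X Y zs"
  unfolding vnorm_alg_tensor
  by (rule cInf_lower) (auto intro!: bdd_belowI2[where m = 0] bdd_belowI[where m = 0] tensor_weight_nonneg)

text \<open>Membership supplies a representing list, so the infimum ranges over a non-empty set and
  lies above every lower bound of the costs.\<close>

lemma norm_ge:
  assumes "u \<in> vecs (alg_tensor X Y)"
    and "\<And>zs. \<lbrakk>set zs \<subseteq> vecs X \<times> vecs Y; u = tensor_of X Y zs\<rbrakk> \<Longrightarrow> r \<le> tensor_weight X Y zs"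
  shows "r \<le> vnorm (alg_tensor X Y) u"
  unfolding vnorm_alg_tensor
  by (rule cInf_greatest) (use assms in \<open>auto simp: vecs_alg_tensor\<close>)

lemma norm_lessE:
  assumes "u \<in> vecs (alg_tensor X Y)" and "vnorm (alg_tensor X Y) u < r"
  obtains zs where "set zs \<subseteq> vecs X \<times> vecs Y" "u = tensor_of X Y zs" "tensor_weight X Y zs < r"
  using norm_ge[OF assms(1), of r] assms(2) by (meson not_le)

lemma scaled_list:
  fixes c :: real
  assumes "set zs \<subseteq> vecs X \<times> vecs Y"
  defines "zs' \<equiv> map (\<lambda>(x, y). (vscale X c x, y)) zs"
  shows "set zs' \<subseteq> vecs X \<times> vecs Y"
    and "tensor_of X Y zs' = (\<lambda>B. c * tensor_of X Y zs B)"
    and "tensor_weight X Y zs' = \<bar>c\<bar> * tensor_weight X Y zs"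
proof -
  show "set zs' \<subseteq> vecs X \<times> vecs Y"
    using assms by (auto simp: X.vscale_mem)
  show "tensor_of X Y zs' = (\<lambda>B. c * tensor_of X Y zs B)"
  proof
    fix B
    show "tensor_of X Y zs' B = c * tensor_of X Y zs B"
      unfolding zs'_def using assms(1)
      by (induction zs)
        (auto simp: tensor_of_Nil tensor_of_Cons pure_tensor_def bilinear_form_def distrib_left)
  qed
  show "tensor_weight X Y zs' = \<bar>c\<bar> * tensor_weight X Y zs"
    unfolding zs'_def using assms(1)
    by (induction zs) (auto simp: X.vnorm_vscale distrib_left)
qed

text \<open>Concatenating nearly optimal lists gives the triangle inequality; scaling the first
  factors gives homogeneity.\<close>

sublocale alg: function_seminorm "alg_tensor X Y"
proof
  show "vadd (alg_tensor X Y) = (+)" "vzero (alg_tensor X Y) = 0"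
    "vscale (alg_tensor X Y) = (\<lambda>c u b. c * u b)"
    by (auto simp: alg_tensor_def fun_eq_iff)
  show "0 \<in> vecs (alg_tensor X Y)"
    unfolding vecs_alg_tensor by (rule exI[of _ "[]"]) (simp add: tensor_of_Nil)
next
  fix u v
  assume u: "u \<in> vecs (alg_tensor X Y)" and v: "v \<in> vecs (alg_tensor X Y)"
  then obtain zs zs' where "set zs \<subseteq> vecs X \<times> vecs Y" "u = tensor_of X Y zs"
    "set zs' \<subseteq> vecs X \<times> vecs Y" "v = tensor_of X Y zs'"
    unfolding vecs_alg_tensor by blast
  then show "u + v \<in> vecs (alg_tensor X Y)"
    using tensor_of_mem[of "zs @ zs'"] by (simp add: tensor_of_append)
  show "vnorm (alg_tensor X Y) (u + v) \<le> vnorm (alg_tensor X Y) u + vnorm (alg_tensor X Y) v"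
  proof (rule field_le_epsilon)
    fix e :: real
    assume e: "e > 0"
    have lt: "r < r + e / 2" for r
      using e by simp
    from norm_lessE[OF u lt] obtain zs where zs: "set zs \<subseteq> vecs X \<times> vecs Y" "u = tensor_of X Y zs"
      "tensor_weight X Y zs < vnorm (alg_tensor X Y) u + e / 2" .
    from norm_lessE[OF v lt] obtain zs' where zs': "set zs' \<subseteq> vecs X \<times> vecs Y" "v = tensor_of X Y zs'"
      "tensor_weight X Y zs' < vnorm (alg_tensor X Y) v + e / 2" .
    show "vnorm (alg_tensor X Y) (u + v) \<le> vnorm (alg_tensor X Y) u + vnorm (alg_tensor X Y) v + e"
      using norm_tensor_of_le[of "zs @ zs'"] zs zs' by (simp add: tensor_of_append)
  qed
next
  have mem: "(\<lambda>b. c * u b) \<in> vecs (alg_tensor X Y)" if "u \<in> vecs (alg_tensor X Y)" for u c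
    using that scaled_list(1,2)[of _ c] unfolding vecs_alg_tensor by metis
  have le: "vnorm (alg_tensor X Y) (\<lambda>b. c * u b) \<le> \<bar>c\<bar> * vnorm (alg_tensor X Y) u"
    if u: "u \<in> vecs (alg_tensor X Y)" and c: "c \<noteq> 0" for u c
  proof -
    have "vnorm (alg_tensor X Y) (\<lambda>b. c * u b) / \<bar>c\<bar> \<le> vnorm (alg_tensor X Y) u"
    proof (rule norm_ge[OF u])
      fix zs
      assume zs: "set zs \<subseteq> vecs X \<times> vecs Y" "u = tensor_of X Y zs"
      show "vnorm (alg_tensor X Y) (\<lambda>b. c * u b) / \<bar>c\<bar> \<le> tensor_weight X Y zs"
        using norm_tensor_of_le[OF scaled_list(1)[OF zs(1), of c]] scaled_list(2,3)[OF zs(1), of c] zs c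
        by (simp add: divide_le_eq mult.commute)
    qed
    then show ?thesis
      using c by (simp add: divide_le_eq mult.commute)
  qed
  have zero: "vnorm (alg_tensor X Y) (\<lambda>b. 0) = 0"
  proof (rule antisym)
    have "tensor_of X Y [] = (\<lambda>b. 0)"
      by (simp add: tensor_of_Nil zero_fun_def)
    then show "vnorm (alg_tensor X Y) (\<lambda>b. 0) \<le> 0"
      using norm_tensor_of_le[of "[]"] by simp
    from \<open>tensor_of X Y [] = (\<lambda>b. 0)\<close> have "(\<lambda>b. 0) \<in> vecs (alg_tensor X Y)"
      using tensor_of_mem[of "[]"] by simp
    then show "0 \<le> vnorm (alg_tensor X Y) (\<lambda>b. 0)"
      by (rule norm_ge) (rule tensor_weight_nonneg)
  qed
  fix u c
  assume u: "u \<in> vecs (alg_tensor X Y)"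
  show "(\<lambda>b. c * u b) \<in> vecs (alg_tensor X Y)"
    by (rule mem[OF u])
  show "vnorm (alg_tensor X Y) (\<lambda>b. c * u b) = \<bar>c\<bar> * vnorm (alg_tensor X Y) u"
  proof (cases "c = 0")
    case False
    \<comment> \<open>The reverse inequality is \<open>le\<close> for the inverse scalar, applied to
      the scaled tensor.\<close>
    have "vnorm (alg_tensor X Y) u \<le> \<bar>inverse c\<bar> * vnorm (alg_tensor X Y) (\<lambda>b. c * u b)"
      using le[OF mem[OF u, of c], of "inverse c"] False by (simp add: mult.assoc[symmetric])
    then have "\<bar>c\<bar> * vnorm (alg_tensor X Y) u \<le> vnorm (alg_tensor X Y) (\<lambda>b. c * u b)"
      using False by (simp add: field_simps)
    with le[OF u False] show ?thesis
      by simp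
  qed (simp add: zero)
qed

lemma pure_tensor_mem:
  "\<lbrakk>x \<in> vecs X; y \<in> vecs Y\<rbrakk> \<Longrightarrow> pure_tensor X Y x y \<in> vecs (alg_tensor X Y)"
  using tensor_of_mem[of "[(x, y)]"] by (simp add: tensor_of_Cons tensor_of_Nil)

section \<open>Norm attainment by repeated splitting\<close>

lemma lim_norm_triangle:
  assumes s: "s \<in> cauchy_seqs (alg_tensor X Y)"
    and u: "u \<in> vecs (alg_tensor X Y)" and v: "v \<in> vecs (alg_tensor X Y)"
  shows "lim (\<lambda>n. vnorm (alg_tensor X Y) (s n - u)) \<le>
         lim (\<lambda>n. vnorm (alg_tensor X Y) (s n - v)) + vnorm (alg_tensor X Y) (v - u)"
proof (rule LIMSEQ_le)
  show "(\<lambda>n. vnorm (alg_tensor X Y) (s n - u)) \<longlonglongrightarrow> lim (\<lambda>n. vnorm (alg_tensor X Y) (s n - u))"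
    by (rule alg.cauchy_norm_tendsto[OF alg.cauchy_diff_const[OF s u]])
  show "(\<lambda>n. vnorm (alg_tensor X Y) (s n - v) + vnorm (alg_tensor X Y) (v - u)) \<longlonglongrightarrow>
      lim (\<lambda>n. vnorm (alg_tensor X Y) (s n - v)) + vnorm (alg_tensor X Y) (v - u)"
    by (intro tendsto_add tendsto_const alg.cauchy_norm_tendsto alg.cauchy_diff_const s v)
  show "\<exists>N. \<forall>n\<ge>N. vnorm (alg_tensor X Y) (s n - u) \<le>
      vnorm (alg_tensor X Y) (s n - v) + vnorm (alg_tensor X Y) (v - u)"
    using alg.norm_triangle_diff[OF alg.cauchy_memD[OF s] v u] by blast
qed

lemma lim_norm_nonneg:
  assumes "s \<in> cauchy_seqs (alg_tensor X Y)"
  shows "0 \<le> lim (\<lambda>n. vnorm (alg_tensor X Y) (s n))"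
  by (rule LIMSEQ_le_const[OF alg.cauchy_norm_tendsto[OF assms]])
     (auto intro: alg.norm_nonneg alg.cauchy_memD[OF assms])

text \<open>
  \<open>split\<close> is applied again and again to the remainder, which decays geometrically; the finite lists
  it yields are concatenated.
\<close>

theorem NA_proj_eqI:
  fixes c :: real
  assumes c: "0 < c" "c \<le> 1"
    and split: "\<And>s. \<lbrakk>s \<in> cauchy_seqs (alg_tensor X Y); 0 < lim (\<lambda>n. vnorm (alg_tensor X Y) (s n))\<rbrakk> \<Longrightarrow>
      \<exists>zs. set zs \<subseteq> vecs X \<times> vecs Y \<and>
        lim (\<lambda>n. vnorm (alg_tensor X Y) (s n - tensor_of X Y zs))
          \<le> lim (\<lambda>n. vnorm (alg_tensor X Y) (s n)) - tensor_weight X Y zs \<and>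
        c * lim (\<lambda>n. vnorm (alg_tensor X Y) (s n)) \<le> tensor_weight X Y zs"
  shows "NA_proj X Y = vecs (proj_tensor X Y)"
proof (rule antisym)
  show "vecs (proj_tensor X Y) \<subseteq> NA_proj X Y"
  proof
    fix u
    assume u: "u \<in> vecs (proj_tensor X Y)"
    define V where "V = alg_tensor X Y"
    define T where "T = tensor_of X Y"
    define w where "w = tensor_weight X Y"
    define D where "D = vecs X \<times> vecs Y"
    obtain s where s: "s \<in> cauchy_seqs V" and us: "u = null_rel V `` {s}"
      using u unfolding proj_tensor_def V_def by (rule alg.vecs_completionE)
    \<comment> \<open>\<open>L P\<close> is the norm, in the completion, of what is left of
      \<open>u\<close> after the tensors of \<open>P\<close> have been subtracted.\<close>
    define L where "L P = lim (\<lambda>n. vnorm V (s n - T P))" for P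
    define l where "l = lim (\<lambda>n. vnorm V (s n))"
    have T_mem: "T P \<in> vecs V" if "set P \<subseteq> D" for P
      using that by (simp add: T_def V_def D_def tensor_of_mem)
    have T_append: "T (P @ Q) = T P + T Q" and w_append: "w (P @ Q) = w P + w Q" for P Q
      by (simp_all add: T_def w_def tensor_of_append)
    have L_append: "L P \<le> L (P @ Q) + w Q" if "set P \<subseteq> D" "set Q \<subseteq> D" for P Q
    proof -
      have "T (P @ Q) \<in> vecs V"
        using that by (intro T_mem) auto
      then have "L P \<le> L (P @ Q) + vnorm V (T (P @ Q) - T P)"
        unfolding L_def using lim_norm_triangle s T_mem[OF that(1)] by (simp add: V_def)
      also have "T (P @ Q) - T P = T Q"
        by (simp add: T_append)
      also have "vnorm V (T Q) \<le> w Q"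
        using norm_tensor_of_le[of Q] that by (simp add: V_def T_def w_def D_def)
      finally show ?thesis
        by simp
    qed
    have L_append_le: "L (P @ Q) \<le> L P + w Q" if "set P \<subseteq> D" "set Q \<subseteq> D" for P Q
    proof -
      have "T (P @ Q) \<in> vecs V"
        using that by (intro T_mem) auto
      then have "L (P @ Q) \<le> L P + vnorm V (T P - T (P @ Q))"
        unfolding L_def using lim_norm_triangle s T_mem[OF that(1)] by (simp add: V_def)
      also have "T P - T (P @ Q) = - T Q"
        by (simp add: T_append)
      also have "vnorm V (- T Q) \<le> w Q"
        using norm_tensor_of_le[of Q] that alg.norm_minus[folded V_def, OF T_mem[OF that(2)]]
        by (simp add: V_def T_def w_def D_def)
      finally show ?thesis
        by simp
    qed
    have L_Nil: "L [] = l"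
      by (simp add: L_def l_def T_def tensor_of_Nil)
    have L_nonneg: "0 \<le> L P" if "set P \<subseteq> D" for P
      unfolding L_def using that
      by (intro lim_norm_nonneg[folded V_def] alg.cauchy_diff_const[folded V_def] s T_mem)
    \<comment> \<open>Always \<open>l \<le> L P + w P\<close>, by \<open>L_append\<close> from the
      empty list. So \<open>G P\<close> says that subtracting \<open>P\<close> lowers the norm by
      exactly the cost of \<open>P\<close>.\<close>
    define G where "G P \<longleftrightarrow> set P \<subseteq> D \<and> L P \<le> l - w P" for P
    \<comment> \<open>Each extension removes at least the fraction \<open>c\<close> of the norm not
      yet accounted for. It is non-empty so that the iterated lists grow into an infinite
      sequence.\<close>
    have "\<exists>Q. Q \<noteq> [] \<and> G (P @ Q) \<and> l - w (P @ Q) \<le> (1 - c) * (l - w P)" if P: "G P" for P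
    proof (cases "0 < L P")
      case True
      have PD: "set P \<subseteq> D"
        using P by (simp add: G_def)
      have "(\<lambda>n. s n - T P) \<in> cauchy_seqs V"
        using alg.cauchy_diff_const[folded V_def, OF s T_mem[OF PD]] .
      from split[folded V_def T_def w_def D_def, OF this True[unfolded L_def]] obtain Q where
        Q: "set Q \<subseteq> D" "lim (\<lambda>n. vnorm V (s n - T P - T Q)) \<le> L P - w Q" "c * L P \<le> w Q"
        unfolding L_def by blast
      have "L (P @ Q) = lim (\<lambda>n. vnorm V (s n - T P - T Q))"
        by (simp only: L_def T_append diff_diff_eq)
      then have "L (P @ Q) \<le> L P - w Q"
        using Q(2) by simp
      moreover have "l \<le> L P + w P"
        using L_append[of "[]" P] PD by (simp add: L_Nil)
      \<comment> \<open>As \<open>l - w P\<close> is at most \<open>L P\<close>, the share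
        \<open>c\<close> of \<open>L P\<close> that \<open>split\<close> guarantees is also a share
        of \<open>l - w P\<close>; this gives the factor \<open>1 - c\<close>.\<close>
      moreover have "c * (l - w P) \<le> c * L P"
        using c calculation(2) by (intro mult_left_mono) auto
      moreover have "0 < c * L P"
        using True c by simp
      moreover have "Q \<noteq> []"
        using Q(3) calculation(4) by (auto simp: w_def)
      ultimately show ?thesis
        using P Q by (intro exI[of _ Q]) (auto simp: G_def w_append algebra_simps)
    next
      case False
      have PD: "set P \<subseteq> D"
        using P by (simp add: G_def)
      have "L P = 0"
        using False L_nonneg[OF PD] by simp
      \<comment> \<open>Nothing is left to split off, and the list is padded with a pair of zeros,
        which costs nothing and keeps the extension non-empty.\<close>
      let ?Q = "[(vzero X, vzero Y)]"
      have Q: "set ?Q \<subseteq> D" "w ?Q = 0"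
        by (simp_all add: D_def X.vzero_mem Y.vzero_mem w_def X.vnorm_vzero)
      have "L (P @ ?Q) \<le> L P + w ?Q"
        by (rule L_append_le[OF PD Q(1)])
      then have "G (P @ ?Q)"
        using P Q by (simp add: G_def w_append)
      moreover have "l - w P \<le> 0"
        using L_append[of "[]" P] PD \<open>L P = 0\<close> by (simp add: L_Nil)
      moreover from this have "c * (l - w P) \<le> 0"
        using c by (intro mult_nonneg_nonpos) auto
      ultimately show ?thesis
        by (intro exI[of _ ?Q]) (simp add: w_append Q algebra_simps)
    qed
    then obtain ext where ext: "\<And>P. G P \<Longrightarrow>
        ext P \<noteq> [] \<and> G (P @ ext P) \<and> l - w (P @ ext P) \<le> (1 - c) * (l - w P)"
      by metis
    define Z where "Z = rec_nat [] (\<lambda>_ P. P @ ext P)"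
    have Z_0: "Z 0 = []" and Z_Suc: "Z (Suc n) = Z n @ ext (Z n)" for n
      by (simp_all add: Z_def)
    have G_Z: "G (Z n)" for n
    proof (induction n)
      case 0
      show ?case
        by (simp add: Z_0 G_def L_Nil w_def)
    next
      case (Suc n)
      then show ?case
        using ext by (simp add: Z_Suc)
    qed
    have w_Z: "l - w (Z n) \<le> (1 - c) ^ n * l" for n
    proof (induction n)
      case 0
      show ?case
        by (simp add: Z_0 w_def)
    next
      case (Suc n)
      have "l - w (Z (Suc n)) \<le> (1 - c) * (l - w (Z n))"
        using ext[OF G_Z] by (simp add: Z_Suc)
      also have "\<dots> \<le> (1 - c) * ((1 - c) ^ n * l)"
        using c Suc by (intro mult_left_mono) auto
      finally show ?case
        by simp
    qed
    have length_Z: "n \<le> length (Z n)" for n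
    proof (induction n)
      case (Suc n)
      have "0 < length (ext (Z n))"
        using ext[OF G_Z] by simp
      with Suc show ?case
        unfolding Z_Suc length_append by linarith
    qed simp
    have prefix: "\<exists>Q. Z n = Z m @ Q" if "m \<le> n" for m n
      using that
    proof (induction n rule: dec_induct)
      case (step n)
      then show ?case
        by (auto simp: Z_Suc)
    qed simp
    \<comment> \<open>The sequence of which all \<open>Z n\<close> are initial segments. The index
      \<open>Suc i\<close> guarantees that entry \<open>i\<close> exists, since
      \<open>Z (Suc i)\<close> has at least \<open>i + 1\<close> entries.\<close>
    define z where "z i = Z (Suc i) ! i" for i
    have z_eq: "Z n ! i = z i" if "i < length (Z n)" for n i
    proof -
      have "i < length (Z (Suc i))"
        using length_Z[of "Suc i"] by simp
      then show ?thesis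
        unfolding z_def using that prefix[of n "Suc i"] prefix[of "Suc i" n]
        by (metis nat_le_linear nth_append)
    qed
    define P where "P n = map z [0..<n]" for n
    have Z_split: "\<exists>Q. Z n = P i @ Q" if "i \<le> length (Z n)" for n i
    proof -
      have "take i (Z n) = P i"
        using that by (intro nth_equalityI) (auto simp: P_def z_eq)
      then show ?thesis
        by (metis append_take_drop_id)
    qed
    \<comment> \<open>All partial sums must converge, not only those at the block ends
      \<open>Z n\<close>. A prefix inherits \<open>G\<close>: putting back the tail \<open>Q\<close>
      raises the remainder by at most \<open>w Q\<close>.\<close>
    have G_P: "G (P i)" for i
    proof -
      obtain Q where Q: "Z i = P i @ Q"
        using Z_split[of i i] length_Z by auto
      then have "set (P i) \<subseteq> D" "set Q \<subseteq> D" "L (P i @ Q) \<le> l - w (P i @ Q)"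
        using G_Z[of i] by (auto simp: G_def)
      then show ?thesis
        using L_append[of "P i" Q] by (simp add: G_def w_append)
    qed
    have w_P_le: "w (P i) \<le> l" for i
      using G_P[of i] L_nonneg[of "P i"] by (simp add: G_def)
    have w_P: "(\<lambda>i. w (P i)) \<longlonglongrightarrow> l"
    proof (rule LIMSEQ_I)
      fix e :: real
      assume "e > 0"
      moreover have "(\<lambda>n. (1 - c) ^ n * l) \<longlonglongrightarrow> 0"
        using c by (intro tendsto_mult_left_zero LIMSEQ_power_zero) auto
      ultimately obtain n where n: "norm ((1 - c) ^ n * l) < e"
        by (fastforce dest: LIMSEQ_D)
      \<comment> \<open>Costs are non-negative, so beyond the block \<open>Z n\<close> the value
        \<open>w (P i)\<close> stays between \<open>w (Z n)\<close> and \<open>l\<close>.\<close>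
      have "norm (w (P i) - l) < e" if "i \<ge> length (Z n)" for i
      proof -
        have "map z [0..<length (Z n)] = Z n"
          by (intro nth_equalityI) (auto simp: z_eq)
        then have "P i = Z n @ map z [length (Z n)..<i]"
          using that by (metis P_def le_add_diff_inverse map_append upt_add_eq_append zero_le)
        moreover have "set (P i) \<subseteq> D"
          using G_P by (simp add: G_def)
        ultimately have "w (Z n) \<le> w (P i)"
          using tensor_weight_nonneg[of "map z [length (Z n)..<i]"] by (auto simp: w_append D_def w_def)
        then show ?thesis
          using w_Z[of n] w_P_le[of i] n by simp
      qed
      then show "\<exists>no. \<forall>n\<ge>no. norm (w (P n) - l) < e"
        by blast
    qed
    have z_mem: "fst (z i) \<in> vecs X" "snd (z i) \<in> vecs Y" for i
    proof -
      have "z i \<in> set (P (Suc i))"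
        by (simp add: P_def)
      then have "z i \<in> D"
        using G_P[of "Suc i"] by (auto simp: G_def)
      then show "fst (z i) \<in> vecs X" "snd (z i) \<in> vecs Y"
        by (auto simp: D_def)
    qed
    have L_P: "(\<lambda>i. L (P i)) \<longlonglongrightarrow> 0"
    proof (rule tendsto_sandwich[OF _ _ tendsto_const])
      show "(\<lambda>i. l - w (P i)) \<longlonglongrightarrow> 0"
        using tendsto_diff[OF tendsto_const[of l] w_P] by simp
    qed (use G_P L_nonneg in \<open>auto simp: G_def intro!: always_eventually\<close>)
    have T_P: "T (P n) = (\<Sum>i<n. pure_tensor X Y (fst (z i)) (snd (z i)))" for n
      unfolding T_def P_def by (rule tensor_of_map_upt)
    have "attains_proj_norm X Y u"
      unfolding attains_proj_norm_def
    proof (intro exI[of _ "fst \<circ> z"] exI[of _ "snd \<circ> z"] conjI allI)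
      show "series_sums (proj_tensor X Y) (\<lambda>i. elem_tensor X Y ((fst \<circ> z) i) ((snd \<circ> z) i)) u"
        unfolding us proj_tensor_def elem_tensor_def V_def comp_def
      proof (rule alg.series_sums_completion_embed)
        show "(\<lambda>n. lim (\<lambda>m. vnorm (alg_tensor X Y) (s m - (\<Sum>i<n. pure_tensor X Y (fst (z i)) (snd (z i)))))) \<longlonglongrightarrow> 0"
          using L_P by (simp only: L_def T_P V_def)
      qed (use s in \<open>auto simp: V_def pure_tensor_mem z_mem\<close>)
      have "vnorm (proj_tensor X Y) u = l"
        using alg.vnorm_completion[folded V_def, OF s] by (simp add: us l_def proj_tensor_def V_def)
      then show "(\<lambda>i. vnorm X ((fst \<circ> z) i) * vnorm Y ((snd \<circ> z) i)) sums vnorm (proj_tensor X Y) u"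
        using w_P by (simp add: sums_def w_def P_def tensor_weight_map_upt)
    qed (simp_all add: z_mem)
    then show "u \<in> NA_proj X Y"
      using u by (simp add: NA_proj_def)
  qed
qed (simp add: NA_proj_def)

end

section \<open>The space of integrable functions\<close>

lemma equiv_ae_rel: "equiv {f. integrable M f} (ae_rel M)"
proof (rule equivI)
  show "trans (ae_rel M)"
    by (rule transI) (auto simp: ae_rel_def elim: AE_mp)
qed (auto simp: refl_on_def ae_rel_def intro!: symI elim: AE_mp)

definition L1_class :: "'a measure \<Rightarrow> ('a \<Rightarrow> real) \<Rightarrow> ('a \<Rightarrow> real) set" where
  "L1_class M f = ae_rel M `` {f}"

lemma L1_class_mem: "integrable M f \<Longrightarrow> L1_class M f \<in> vecs (L1_space M)"
  by (simp add: L1_class_def L1_space_def quotientI)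

lemma vecs_L1E:
  assumes "a \<in> vecs (L1_space M)"
  obtains f where "integrable M f" "a = L1_class M f"
  using assms by (auto simp: L1_class_def L1_space_def elim: quotientE)

lemma mem_L1_class: "g \<in> L1_class M f \<longleftrightarrow> integrable M f \<and> integrable M g \<and> (AE x in M. f x = g x)"
  by (simp add: L1_class_def ae_rel_def)

lemma L1_class_cong:
  "\<lbrakk>integrable M f; integrable M g; AE x in M. f x = g x\<rbrakk> \<Longrightarrow> L1_class M f = L1_class M g"
  unfolding L1_class_def by (rule equiv_class_eq[OF equiv_ae_rel]) (simp add: ae_rel_def)

lemma vadd_L1_class:
  assumes "integrable M f" "integrable M g"
  shows "vadd (L1_space M) (L1_class M f) (L1_class M g) = L1_class M (\<lambda>x. f x + g x)"
proof -
  have "congruent2 (ae_rel M) (ae_rel M) (\<lambda>f g. L1_class M (\<lambda>x. f x + g x))"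
  proof (rule congruent2I')
    fix f f' g g'
    assume "(f, f') \<in> ae_rel M" "(g, g') \<in> ae_rel M"
    then show "L1_class M (\<lambda>x. f x + g x) = L1_class M (\<lambda>x. f' x + g' x)"
      by (intro L1_class_cong) (auto simp: ae_rel_def)
  qed
  from UN_equiv_class2[OF equiv_ae_rel equiv_ae_rel this] assms show ?thesis
    by (simp add: L1_space_def L1_class_def)
qed

lemma vscale_L1_class:
  assumes "integrable M f"
  shows "vscale (L1_space M) c (L1_class M f) = L1_class M (\<lambda>x. c * f x)"
proof -
  have "congruent (ae_rel M) (\<lambda>f. L1_class M (\<lambda>x. c * f x))"
  proof (rule congruentI)
    fix f g
    assume "(f, g) \<in> ae_rel M"
    then show "L1_class M (\<lambda>x. c * f x) = L1_class M (\<lambda>x. c * g x)"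
      by (intro L1_class_cong) (auto simp: ae_rel_def)
  qed
  from UN_equiv_class[OF equiv_ae_rel this] assms show ?thesis
    by (simp add: L1_space_def L1_class_def)
qed

lemma vnorm_L1_class:
  assumes "integrable M f"
  shows "vnorm (L1_space M) (L1_class M f) = (\<integral>x. \<bar>f x\<bar> \<partial>M)"
proof -
  have "(\<lambda>g. \<integral>x. \<bar>g x\<bar> \<partial>M) ` L1_class M f = (\<lambda>_. \<integral>x. \<bar>f x\<bar> \<partial>M) ` L1_class M f"
    by (intro image_cong integral_cong_AE) (auto simp: mem_L1_class)
  also have "\<dots> = {\<integral>x. \<bar>f x\<bar> \<partial>M}"
    using assms by (intro image_constant[of f]) (simp add: mem_L1_class)
  finally show ?thesis
    by (simp add: L1_space_def)
qed

lemma absolutely_homogeneous_L1: "absolutely_homogeneous (L1_space M)"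
proof
  have zero: "vzero (L1_space M) = L1_class M (\<lambda>_. 0)"
    by (simp add: L1_space_def L1_class_def)
  show "vzero (L1_space M) \<in> vecs (L1_space M)" "vnorm (L1_space M) (vzero (L1_space M)) = 0"
    by (simp_all add: zero L1_class_mem vnorm_L1_class)
qed (auto elim!: vecs_L1E simp: vscale_L1_class vnorm_L1_class L1_class_mem abs_mult)


section \<open>Continuous functions on a compact space\<close>

lemma C_space_mem_iff:
  "f \<in> vecs (C_space K) \<longleftrightarrow> f \<in> extensional (topspace K) \<and> continuous_map K euclideanreal f"
  by (simp add: C_space_def)

lemma C_space_ops:
  "vadd (C_space K) f g = (\<lambda>x\<in>topspace K. f x + g x)"
  "vscale (C_space K) c f = (\<lambda>x\<in>topspace K. c * f x)"
  "vzero (C_space K) = (\<lambda>x\<in>topspace K. 0)"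
  "vnorm (C_space K) f = Sup (insert 0 ((\<lambda>x. \<bar>f x\<bar>) ` topspace K))"
  by (simp_all add: C_space_def)

lemma restrict_mem_C_space:
  assumes "continuous_map K euclideanreal f"
  shows "(\<lambda>x\<in>topspace K. f x) \<in> vecs (C_space K)"
  using assms continuous_map_eq[OF assms, of "\<lambda>x\<in>topspace K. f x"] by (simp add: C_space_mem_iff)

lemma C_space_eqI:
  "\<lbrakk>f \<in> vecs (C_space K); g \<in> vecs (C_space K); \<And>x. x \<in> topspace K \<Longrightarrow> f x = g x\<rbrakk> \<Longrightarrow> f = g"
  by (rule extensionalityI[of _ "topspace K"]) (auto simp: C_space_mem_iff)

locale compact_space_functions =
  fixes K :: "'k topology"
  assumes compact: "compact_space K"
begin

abbreviation "Y \<equiv> C_space K"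

text \<open>Built from the operations of the space, so that differences are again extensional and
  bilinear forms can be expanded on them.\<close>

definition cdiff :: "('k \<Rightarrow> real) \<Rightarrow> ('k \<Rightarrow> real) \<Rightarrow> 'k \<Rightarrow> real" where
  "cdiff f g = vadd Y f (vscale Y (- 1) g)"

lemma cdiff_apply: "x \<in> topspace K \<Longrightarrow> cdiff f g x = f x - g x"
  by (simp add: cdiff_def C_space_ops)

lemma zero_mem: "vzero Y \<in> vecs Y"
  by (simp add: C_space_ops restrict_mem_C_space)

lemma scale_mem: "f \<in> vecs Y \<Longrightarrow> vscale Y c f \<in> vecs Y"
  by (auto simp: C_space_ops C_space_mem_iff intro!: restrict_mem_C_space[unfolded C_space_mem_iff]
      continuous_map_real_mult_left)

lemma add_mem: "\<lbrakk>f \<in> vecs Y; g \<in> vecs Y\<rbrakk> \<Longrightarrow> vadd Y f g \<in> vecs Y"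
  unfolding C_space_ops by (intro restrict_mem_C_space continuous_map_add) (auto simp: C_space_mem_iff)

lemma cdiff_mem: "\<lbrakk>f \<in> vecs Y; g \<in> vecs Y\<rbrakk> \<Longrightarrow> cdiff f g \<in> vecs Y"
  by (simp add: cdiff_def add_mem scale_mem)

lemma cdiff_zero: "f \<in> vecs Y \<Longrightarrow> cdiff f (vzero Y) = f"
  by (rule C_space_eqI[of _ K]) (auto simp: cdiff_mem zero_mem cdiff_apply, simp add: C_space_ops)

lemma compact_abs_image:
  assumes "f \<in> vecs Y"
  shows "compact ((\<lambda>x. \<bar>f x\<bar>) ` topspace K)"
proof -
  have "continuous_map K euclideanreal (\<lambda>x. \<bar>f x\<bar>)"
    using assms by (intro continuous_map_real_abs) (simp add: C_space_mem_iff)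
  then show ?thesis
    using compact image_compactin[of K "topspace K" euclideanreal] by (simp add: compact_space_def)
qed

lemma bdd_above_abs_image: "f \<in> vecs Y \<Longrightarrow> bdd_above ((\<lambda>x. \<bar>f x\<bar>) ` topspace K)"
  by (intro bounded_imp_bdd_above compact_imp_bounded compact_abs_image)

lemma abs_le_norm: "\<lbrakk>f \<in> vecs Y; x \<in> topspace K\<rbrakk> \<Longrightarrow> \<bar>f x\<bar> \<le> vnorm Y f"
  unfolding C_space_ops
  by (rule cSup_upper)
     (auto intro: bdd_above_abs_image)

lemma norm_nonneg: "f \<in> vecs Y \<Longrightarrow> 0 \<le> vnorm Y f"
  unfolding C_space_ops
  by (rule cSup_upper)
     (auto intro: bdd_above_abs_image)

lemma norm_le: "\<lbrakk>0 \<le> r; \<And>x. x \<in> topspace K \<Longrightarrow> \<bar>f x\<bar> \<le> r\<rbrakk> \<Longrightarrow> vnorm Y f \<le> r"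
  unfolding C_space_ops by (rule cSup_least) auto

lemma norm_zero: "vnorm Y (vzero Y) = 0"
  by (rule antisym[OF norm_le norm_nonneg[OF zero_mem]]) (simp_all add: C_space_ops)

lemma norm_eq_0_iff: "f \<in> vecs Y \<Longrightarrow> vnorm Y f = 0 \<longleftrightarrow> f = vzero Y"
proof
  assume "f \<in> vecs Y" "vnorm Y f = 0"
  then show "f = vzero Y"
    using abs_le_norm[of f] by (intro C_space_eqI[of _ K]) (auto simp: zero_mem, simp add: C_space_ops)
qed (simp add: norm_zero)

lemma norm_scale:
  assumes f: "f \<in> vecs Y"
  shows "vnorm Y (vscale Y c f) = \<bar>c\<bar> * vnorm Y f"
proof (rule antisym)
  show "vnorm Y (vscale Y c f) \<le> \<bar>c\<bar> * vnorm Y f"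
    by (rule norm_le)
       (auto simp: C_space_ops(2) abs_mult norm_nonneg f intro!: mult_left_mono abs_le_norm)
  show "\<bar>c\<bar> * vnorm Y f \<le> vnorm Y (vscale Y c f)"
  proof (cases "c = 0")
    case False
    have "vnorm Y f \<le> vnorm Y (vscale Y c f) / \<bar>c\<bar>"
    proof (rule norm_le)
      fix x
      assume "x \<in> topspace K"
      then show "\<bar>f x\<bar> \<le> vnorm Y (vscale Y c f) / \<bar>c\<bar>"
        using abs_le_norm[OF scale_mem[OF f], of x c] False
        by (simp add: C_space_ops(2) abs_mult le_divide_eq mult.commute)
    qed (simp add: norm_nonneg scale_mem f)
    then show ?thesis
      using False by (simp add: le_divide_eq mult.commute)
  qed (simp add: norm_nonneg scale_mem f)
qed

lemma norm_triangle:
  assumes "f \<in> vecs Y" "g \<in> vecs Y" "h \<in> vecs Y"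
  shows "vnorm Y (cdiff f h) \<le> vnorm Y (cdiff f g) + vnorm Y (cdiff g h)"
proof (rule norm_le)
  fix x
  assume x: "x \<in> topspace K"
  have "\<bar>f x - g x\<bar> \<le> vnorm Y (cdiff f g)" "\<bar>g x - h x\<bar> \<le> vnorm Y (cdiff g h)"
    using abs_le_norm[OF cdiff_mem x] assms by (simp_all add: x flip: cdiff_apply)
  then show "\<bar>cdiff f h x\<bar> \<le> vnorm Y (cdiff f g) + vnorm Y (cdiff g h)"
    by (simp add: x cdiff_apply)
qed (simp add: assms norm_nonneg cdiff_mem)

text \<open>A non-zero function forces \<open>K\<close> to be non-empty, and then the compact image
  of its absolute value has a maximum.\<close>

lemma norm_attained:
  assumes "f \<in> vecs Y" "f \<noteq> vzero Y"
  shows "\<exists>x\<in>topspace K. \<bar>f x\<bar> = vnorm Y f"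
proof -
  have "topspace K \<noteq> {}"
    using assms norm_eq_0_iff[OF assms(1)] by (auto simp: C_space_ops)
  then obtain x where x: "x \<in> topspace K" "\<And>y. y \<in> topspace K \<Longrightarrow> \<bar>f y\<bar> \<le> \<bar>f x\<bar>"
    using compact_attains_sup[OF compact_abs_image[OF assms(1)]] by auto
  then have "vnorm Y f = \<bar>f x\<bar>"
    by (intro antisym norm_le abs_le_norm assms(1)) auto
  then show ?thesis
    using x by auto
qed

sublocale absolutely_homogeneous Y
  by unfold_locales (auto simp: zero_mem scale_mem norm_zero norm_nonneg norm_scale)

end

section \<open>Clopen separation and continuous sign functions\<close>

locale stone_space_functions = compact_space_functions K for K :: "'k topology" +
  assumes Hausdorff: "Hausdorff_space K" and totally_disconnected: "totally_disconnected_space K"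
begin

text \<open>In a compact Hausdorff space quasi-components are components, so total disconnectedness
  separates distinct points by clopen sets. Compactness of \<open>S\<close> and of \<open>T\<close>
  then passes from points to closed sets, one side at a time.\<close>

lemma separated_between_closed:
  assumes "closedin K S" "closedin K T" "S \<inter> T = {}"
  shows "separated_between K S T"
proof -
  have "separated_between K {x} {y}" if "x \<in> topspace K" "y \<in> topspace K" "x \<noteq> y" for x y
  proof -
    have "\<not> connected_component_of K x y"
      using totally_disconnected that unfolding totally_disconnected_space_def connected_component_of_def
      by (metis empty_iff singletonD)
    then have "\<not> quasi_component_of K x y"
      using compact Hausdorff by (simp add: quasi_eq_connected_component_of)
    then show ?thesis
      using that by (simp add: separated_between_singletons)
  qed
  moreover have "compactin K S" "compactin K T" "S \<subseteq> topspace K" "T \<subseteq> topspace K"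
    using assms by (auto simp: closedin_compact_space compact closedin_subset)
  ultimately show ?thesis
    using assms(3)
    by (auto simp: separated_between_pointwise_left[of K S] separated_between_pointwise_right[of K T] disjoint_iff)
       (metis subsetD)
qed

text \<open>Since \<open>r\<close> is positive, the two level sets are disjoint closed sets, and a
  clopen set separates them. The function 1 on it and -1 off it is locally constant; where
  \<open>f\<close> is strictly between \<open>- r\<close> and \<open>r\<close> the sign is left to
  chance.\<close>

lemma sign_function:
  assumes f: "f \<in> vecs Y" and r: "0 < r"
  shows "\<exists>e\<in>vecs Y. \<forall>x\<in>topspace K. (e x = 1 \<or> e x = - 1) \<and> (r \<le> f x \<longrightarrow> e x = 1) \<and> (f x \<le> - r \<longrightarrow> e x = - 1)"
proof -
  have cont: "continuous_map K euclideanreal f"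
    using f by (simp add: C_space_mem_iff)
  have "closedin K {x \<in> topspace K. f x \<in> {r..}}" "closedin K {x \<in> topspace K. f x \<in> {..- r}}"
    by (intro closedin_continuous_map_preimage[OF cont]; simp)+
  then have "separated_between K {x \<in> topspace K. r \<le> f x} {x \<in> topspace K. f x \<le> - r}"
    using r by (intro separated_between_closed) auto
  then obtain U V where UV: "openin K U" "openin K V" "U \<union> V = topspace K" "U \<inter> V = {}"
      "{x \<in> topspace K. r \<le> f x} \<subseteq> U" "{x \<in> topspace K. f x \<le> - r} \<subseteq> V"
    by (auto simp: separated_between_def disjnt_def)
  define e :: "'k \<Rightarrow> real" where "e x = (if x \<in> U then 1 else - 1)" for x
  have "continuous_map K euclideanreal e"
    unfolding continuous_map_def
  proof (intro conjI allI impI)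
    fix W :: "real set"
    have "{x \<in> topspace K. e x \<in> W} = (if 1 \<in> W then U else {}) \<union> (if - 1 \<in> W then V else {})"
      using UV(3,4) by (auto simp: e_def split: if_splits)
    then show "openin K {x \<in> topspace K. e x \<in> W}"
      using UV by auto
  qed simp
  then show ?thesis
    using UV by (intro bexI[OF _ restrict_mem_C_space[of K e]]) (auto simp: e_def)
qed

end

section \<open>Simple functions with values in \<open>C(K)\<close>\<close>

lemma bilinear_L1_zero:
  assumes B: "bilinear_form (L1_space M) Y B" and y: "y \<in> vecs Y"
  shows "B (L1_class M (\<lambda>_. 0)) y = 0"
proof -
  have "B (vscale (L1_space M) 0 (L1_class M (\<lambda>_. 0))) y = 0 * B (L1_class M (\<lambda>_. 0)) y"
    using B y L1_class_mem[of M "\<lambda>_. 0"] unfolding bilinear_form_def by blast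
  then show ?thesis
    by (simp add: vscale_L1_class)
qed

lemma bilinear_L1_sum:
  assumes B: "bilinear_form (L1_space M) Y B" and y: "y \<in> vecs Y"
    and "\<And>i. i \<in> I \<Longrightarrow> integrable M (f i)"
  shows "B (L1_class M (\<lambda>x. \<Sum>i\<in>I. f i x)) y = (\<Sum>i\<in>I. B (L1_class M (f i)) y)"
  using assms(3)
proof (induction I rule: infinite_finite_induct)
  case (insert i I)
  then have "L1_class M (\<lambda>x. \<Sum>i\<in>insert i I. f i x) =
      vadd (L1_space M) (L1_class M (f i)) (L1_class M (\<lambda>x. \<Sum>i\<in>I. f i x))"
    by (simp add: vadd_L1_class)
  moreover have "L1_class M (f i) \<in> vecs (L1_space M)"
      "L1_class M (\<lambda>x. \<Sum>i\<in>I. f i x) \<in> vecs (L1_space M)"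
    using insert by (auto intro: L1_class_mem)
  ultimately show ?case
    using insert B y by (simp add: bilinear_form_def)
qed (simp_all add: bilinear_L1_zero[OF B y])

lemma bilinear_L1_scale:
  assumes "bilinear_form (L1_space M) Y B" "y \<in> vecs Y" "integrable M f"
  shows "B (L1_class M (\<lambda>x. c * f x)) y = c * B (L1_class M f) y"
  using assms L1_class_mem[OF assms(3)] by (simp add: bilinear_form_def flip: vscale_L1_class)

locale L1_tensor_C = compact_space_functions K
  for K :: "'k topology" and M :: "'w measure"
begin

abbreviation "X \<equiv> L1_space M"
abbreviation "V \<equiv> alg_tensor X Y"

sublocale ten: tensor_factors X Y
  unfolding tensor_factors_def using absolutely_homogeneous_L1 absolutely_homogeneous_axioms by blast

definition fiber :: "('w \<Rightarrow> 'c) \<Rightarrow> 'c \<Rightarrow> 'w set" where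
  "fiber F y = {\<omega> \<in> space M. F \<omega> = y}"

text \<open>The measure is arbitrary, so a support of finite measure is demanded to make the
  indicators of the fibers over non-zero values integrable.\<close>

definition csimple :: "('w \<Rightarrow> 'k \<Rightarrow> real) \<Rightarrow> bool" where
  "csimple F \<longleftrightarrow> simple_function M F \<and> (\<forall>\<omega>\<in>space M. F \<omega> \<in> vecs Y) \<and>
     emeasure M {\<omega> \<in> space M. F \<omega> \<noteq> vzero Y} < \<infinity>"

text \<open>The sum of the tensors (indicator of the fiber over \<open>y\<close>) \<otimes>
  \<open>y\<close>, written as a functional so that the values need not be ordered into a list. The
  zero value is omitted because its fiber may have infinite measure.\<close>

definition simple_tensor :: "('w \<Rightarrow> 'k \<Rightarrow> real) \<Rightarrow> (('w \<Rightarrow> real) set, 'k \<Rightarrow> real) tensor" where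
  "simple_tensor F = (\<lambda>B. if bilinear_form X Y B
     then \<Sum>y\<in>F ` space M - {vzero Y}. B (L1_class M (indicator (fiber F y))) y else 0)"

text \<open>A fiber over a value other than \<open>z\<close> lies in the set where \<open>H\<close>
  differs from \<open>z\<close>. The codomain is left general to cover functions into
  \<open>C(K)\<close>, pairs of them, and real functions.\<close>

lemma integrable_indicator_fiber:
  assumes "simple_function M H" "emeasure M {\<omega> \<in> space M. H \<omega> \<noteq> z} < \<infinity>" "h \<noteq> z"
  shows "integrable M (indicator (fiber H h) :: 'w \<Rightarrow> real)"
proof (rule integrable_real_indicator)
  have eq: "fiber H h = H -` {h} \<inter> space M" "{\<omega> \<in> space M. H \<omega> \<noteq> z} = H -` (- {z}) \<inter> space M"
    by (auto simp: fiber_def)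
  show "fiber H h \<in> sets M"
    unfolding eq by (rule simple_functionD[OF assms(1)])
  have "emeasure M (fiber H h) \<le> emeasure M {\<omega> \<in> space M. H \<omega> \<noteq> z}"
  proof (rule emeasure_mono)
    show "{\<omega> \<in> space M. H \<omega> \<noteq> z} \<in> sets M"
      unfolding eq by (rule simple_functionD[OF assms(1)])
  qed (use assms(3) in \<open>auto simp: fiber_def\<close>)
  with assms(2) show "emeasure M (fiber H h) < \<infinity>"
    by (rule le_less_trans[rotated])
qed

text \<open>On \<open>space M\<close> the composition is a finite combination of indicators of
  fibers; \<open>\<psi>\<close> vanishing at zero removes the one fiber that may have infinite
  measure.\<close>

lemma integrable_csimple:
  fixes \<psi> :: "('k \<Rightarrow> real) \<Rightarrow> real"
  assumes F: "csimple F" and zero: "\<psi> (vzero Y) = 0"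
  shows "integrable M (\<lambda>\<omega>. \<psi> (F \<omega>))"
    and "(\<integral>\<omega>. \<psi> (F \<omega>) \<partial>M) = (\<Sum>y\<in>F ` space M - {vzero Y}. \<psi> y * measure M (fiber F y))"
proof -
  define S where "S = F ` space M - {vzero Y}"
  have S: "finite S"
    using F by (auto simp: S_def csimple_def dest: simple_functionD)
  have int: "integrable M (indicator (fiber F y) :: 'w \<Rightarrow> real)" if "y \<in> S" for y
    using F that by (intro integrable_indicator_fiber) (auto simp: csimple_def S_def)
  have eq: "\<psi> (F \<omega>) = (\<Sum>y\<in>S. \<psi> y * indicator (fiber F y) \<omega>)" if "\<omega> \<in> space M" for \<omega>
  proof -
    have "(\<Sum>y\<in>S. \<psi> y * indicator (fiber F y) \<omega>) = (\<Sum>y\<in>S. if y = F \<omega> then \<psi> (F \<omega>) else 0)"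
      using that by (intro sum.cong) (auto simp: fiber_def indicator_def)
    then show ?thesis
      using S that zero by (auto simp: S_def)
  qed
  have "integrable M (\<lambda>\<omega>. \<psi> (F \<omega>)) \<longleftrightarrow> integrable M (\<lambda>\<omega>. \<Sum>y\<in>S. \<psi> y * indicator (fiber F y) \<omega>)"
    by (intro Bochner_Integration.integrable_cong) (simp_all add: eq)
  then show "integrable M (\<lambda>\<omega>. \<psi> (F \<omega>))"
    using int by simp
  have "(\<integral>\<omega>. \<psi> (F \<omega>) \<partial>M) = (\<integral>\<omega>. (\<Sum>y\<in>S. \<psi> y * indicator (fiber F y) \<omega>) \<partial>M)"
    by (intro Bochner_Integration.integral_cong) (simp_all add: eq)
  also have "\<dots> = (\<Sum>y\<in>S. \<psi> y * measure M (fiber F y))"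
    using int by (subst Bochner_Integration.integral_sum)
      (auto intro!: sum.cong arg_cong[where f = "measure M"] simp: fiber_def)
  finally show "(\<integral>\<omega>. \<psi> (F \<omega>) \<partial>M) = (\<Sum>y\<in>F ` space M - {vzero Y}. \<psi> y * measure M (fiber F y))"
    by (simp add: S_def)
qed

lemmas integrable_norm_csimple = integrable_csimple(1)[where \<psi> = "vnorm Y", OF _ norm_zero]

text \<open>The fibers of \<open>F\<close> are unions of those of the finer \<open>H\<close>, and
  \<open>B\<close> is additive in its first argument, so regrouping the sum by the value of
  \<open>\<phi>\<close> is harmless. This allows several simple functions to be evaluated on one
  common partition.\<close>

lemma simple_tensor_partition:
  assumes H: "simple_function M H" "emeasure M {\<omega> \<in> space M. H \<omega> \<noteq> z} < \<infinity>"
    and \<phi>: "\<phi> z = vzero Y" "\<And>h. h \<in> H ` space M \<Longrightarrow> \<phi> h \<in> vecs Y"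
    and F: "\<And>\<omega>. \<omega> \<in> space M \<Longrightarrow> F \<omega> = \<phi> (H \<omega>)"
    and B: "bilinear_form X Y B"
  shows "simple_tensor F B = (\<Sum>h\<in>H ` space M - {z}. B (L1_class M (indicator (fiber H h))) (\<phi> h))"
proof -
  define S where "S = {h \<in> H ` space M - {z}. \<phi> h \<noteq> vzero Y}"
  let ?b = "\<lambda>h. B (L1_class M (indicator (fiber H h)))"
  have fin: "finite (H ` space M)"
    by (rule simple_functionD[OF H(1)])
  have int: "integrable M (indicator (fiber H h) :: 'w \<Rightarrow> real)" if "h \<noteq> z" for h
    by (rule integrable_indicator_fiber[OF H that])
  have B_zero: "B a (vzero Y) = 0" if "a \<in> vecs X" for a
  proof -
    have "B a (vscale Y 0 (vzero Y)) = 0 * B a (vzero Y)"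
      using B that zero_mem unfolding bilinear_form_def by blast
    moreover have "vscale Y 0 (vzero Y) = vzero Y"
      by (simp add: C_space_ops restrict_def fun_eq_iff)
    ultimately show ?thesis
      by simp
  qed
  \<comment> \<open>Values that \<open>\<phi>\<close> sends to zero contribute nothing; removing
    them leaves exactly the preimages of the non-zero values of \<open>F\<close>.\<close>
  have "(\<Sum>h\<in>H ` space M - {z}. ?b h (\<phi> h)) = (\<Sum>h\<in>S. ?b h (\<phi> h))"
    by (rule sum.mono_neutral_right) (auto simp: fin S_def B_zero L1_class_mem int)
  also have "\<dots> = (\<Sum>y\<in>\<phi> ` S. \<Sum>h\<in>{h. h \<in> S \<and> \<phi> h = y}. ?b h (\<phi> h))"
    by (rule sum.image_gen) (simp add: S_def fin)
  also have "\<phi> ` S = F ` space M - {vzero Y}"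
    using \<phi>(1) by (auto simp: S_def F)
  also have "(\<Sum>y\<in>F ` space M - {vzero Y}. \<Sum>h\<in>{h. h \<in> S \<and> \<phi> h = y}. ?b h (\<phi> h)) =
      (\<Sum>y\<in>F ` space M - {vzero Y}. B (L1_class M (indicator (fiber F y))) y)"
  proof (rule sum.cong)
    fix y
    assume y: "y \<in> F ` space M - {vzero Y}"
    let ?A = "{h. h \<in> S \<and> \<phi> h = y}"
    have A: "finite ?A"
      using fin by (auto simp: S_def)
    have int_A: "integrable M (indicator (fiber H h) :: 'w \<Rightarrow> real)" if "h \<in> ?A" for h
      using that by (intro int) (auto simp: S_def)
    have yY: "y \<in> vecs Y"
      using y F \<phi>(2) by auto
    \<comment> \<open>As \<open>y\<close> is non-zero and \<open>\<phi> z\<close> is zero, a point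
      of the fiber over \<open>y\<close> never has \<open>H\<close>-value \<open>z\<close>. So the
      fibers of \<open>H\<close> over \<open>?A\<close> partition the fiber of \<open>F\<close> over
      \<open>y\<close>.\<close>
    have eq: "(\<Sum>h\<in>?A. indicator (fiber H h) \<omega>) = (indicator (fiber F y) \<omega> :: real)"
      if \<omega>: "\<omega> \<in> space M" for \<omega>
    proof -
      have "(\<Sum>h\<in>?A. indicator (fiber H h) \<omega>) = (\<Sum>h\<in>?A. if h = H \<omega> then 1 else (0 :: real))"
        using \<omega> by (intro sum.cong) (auto simp: fiber_def indicator_def)
      also have "\<dots> = (if H \<omega> \<in> ?A then 1 else 0)"
        using A by (simp only: sum.delta)
      also have "\<dots> = indicator (fiber F y) \<omega>"
        using \<omega> y \<phi>(1) by (auto simp: fiber_def S_def F indicator_def)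
      finally show ?thesis .
    qed
    have "integrable M (\<lambda>\<omega>. \<Sum>h\<in>?A. indicator (fiber H h) \<omega> :: real)"
      using int_A by (rule Bochner_Integration.integrable_sum)
    moreover have "integrable M (\<lambda>\<omega>. \<Sum>h\<in>?A. indicator (fiber H h) \<omega> :: real) \<longleftrightarrow>
        integrable M (indicator (fiber F y) :: 'w \<Rightarrow> real)"
      by (intro Bochner_Integration.integrable_cong refl eq)
    ultimately have "L1_class M (indicator (fiber F y)) = L1_class M (\<lambda>\<omega>. \<Sum>h\<in>?A. indicator (fiber H h) \<omega>)"
      by (intro L1_class_cong) (auto simp: eq)
    then have "B (L1_class M (indicator (fiber F y))) y = (\<Sum>h\<in>?A. ?b h y)"
      using bilinear_L1_sum[OF B yY, of ?A "\<lambda>h. indicator (fiber H h)", OF int_A] by (simp only:)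
    then show "(\<Sum>h\<in>?A. ?b h (\<phi> h)) = B (L1_class M (indicator (fiber F y))) y"
      by simp
  qed simp
  finally show ?thesis
    using B by (simp add: simple_tensor_def)
qed

text \<open>The support of the pair is the union of the two supports. Its finite measure is what
  \<open>simple_tensor_partition\<close> asks for when \<open>H\<close> is the pair.\<close>

lemma csimple_compose2:
  assumes F: "csimple F" and G: "csimple G" and \<phi>: "\<phi> (vzero Y) (vzero Y) = vzero Y"
    "\<And>f g. \<lbrakk>f \<in> vecs Y; g \<in> vecs Y\<rbrakk> \<Longrightarrow> \<phi> f g \<in> vecs Y"
  shows "csimple (\<lambda>\<omega>. \<phi> (F \<omega>) (G \<omega>))"
    and "emeasure M {\<omega> \<in> space M. (F \<omega>, G \<omega>) \<noteq> (vzero Y, vzero Y)} < \<infinity>"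
proof -
  have F_eq: "{\<omega> \<in> space M. F \<omega> \<noteq> vzero Y} = F -` (- {vzero Y}) \<inter> space M"
    and G_eq: "{\<omega> \<in> space M. G \<omega> \<noteq> vzero Y} = G -` (- {vzero Y}) \<inter> space M" by auto
  have sets: "{\<omega> \<in> space M. F \<omega> \<noteq> vzero Y} \<in> sets M" "{\<omega> \<in> space M. G \<omega> \<noteq> vzero Y} \<in> sets M"
    unfolding F_eq G_eq using F G by (auto simp: csimple_def intro: simple_functionD)
  have eq: "{\<omega> \<in> space M. (F \<omega>, G \<omega>) \<noteq> (vzero Y, vzero Y)} =
      {\<omega> \<in> space M. F \<omega> \<noteq> vzero Y} \<union> {\<omega> \<in> space M. G \<omega> \<noteq> vzero Y}"
    by auto
  have "emeasure M ({\<omega> \<in> space M. F \<omega> \<noteq> vzero Y} \<union> {\<omega> \<in> space M. G \<omega> \<noteq> vzero Y}) < \<infinity>"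
    using F G by (intro le_less_trans[OF emeasure_subadditive[OF sets]]) (simp add: csimple_def)
  then show fin: "emeasure M {\<omega> \<in> space M. (F \<omega>, G \<omega>) \<noteq> (vzero Y, vzero Y)} < \<infinity>"
    unfolding eq .
  have "emeasure M {\<omega> \<in> space M. \<phi> (F \<omega>) (G \<omega>) \<noteq> vzero Y} \<le>
      emeasure M {\<omega> \<in> space M. (F \<omega>, G \<omega>) \<noteq> (vzero Y, vzero Y)}"
  proof (rule emeasure_mono)
    show "{\<omega> \<in> space M. (F \<omega>, G \<omega>) \<noteq> (vzero Y, vzero Y)} \<in> sets M"
      unfolding eq by (intro sets.Un sets)
  qed (use \<phi>(1) in auto)
  then have "emeasure M {\<omega> \<in> space M. \<phi> (F \<omega>) (G \<omega>) \<noteq> vzero Y} < \<infinity>"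
    using fin by (rule le_less_trans)
  moreover have "simple_function M (\<lambda>\<omega>. \<phi> (F \<omega>) (G \<omega>))"
    using F G by (intro simple_function_compose2[where h = \<phi>]) (simp_all add: csimple_def)
  ultimately show "csimple (\<lambda>\<omega>. \<phi> (F \<omega>) (G \<omega>))"
    using F G \<phi>(2) by (simp add: csimple_def)
qed

lemma cdiff_zero_zero: "cdiff (vzero Y) (vzero Y) = vzero Y"
  by (rule cdiff_zero[OF zero_mem])

lemma csimple_diff: "\<lbrakk>csimple F; csimple G\<rbrakk> \<Longrightarrow> csimple (\<lambda>\<omega>. cdiff (F \<omega>) (G \<omega>))"
  by (rule csimple_compose2(1)[where \<phi> = cdiff]) (auto simp: cdiff_zero_zero cdiff_mem)

text \<open>Over the fibers of the pair of \<open>F\<close> and \<open>G\<close> all three tensors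
  become sums with the same index set, and bilinearity compares them term by term.\<close>

lemma simple_tensor_diff:
  assumes F: "csimple F" and G: "csimple G"
  shows "simple_tensor (\<lambda>\<omega>. cdiff (F \<omega>) (G \<omega>)) = simple_tensor F - simple_tensor G"
proof
  fix B
  show "simple_tensor (\<lambda>\<omega>. cdiff (F \<omega>) (G \<omega>)) B = (simple_tensor F - simple_tensor G) B"
  proof (cases "bilinear_form X Y B")
    case B: True
    let ?H = "\<lambda>\<omega>. (F \<omega>, G \<omega>)"
    let ?b = "\<lambda>h. B (L1_class M (indicator (fiber ?H h)))"
    let ?S = "?H ` space M - {(vzero Y, vzero Y)}"
    have sf: "simple_function M ?H"
      using F G by (intro simple_function_Pair) (simp_all add: csimple_def)
    have fin: "emeasure M {\<omega> \<in> space M. ?H \<omega> \<noteq> (vzero Y, vzero Y)} < \<infinity>"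
      by (rule csimple_compose2(2)[OF F G, where \<phi> = cdiff]) (auto simp: cdiff_zero_zero cdiff_mem)
    have mem: "fst h \<in> vecs Y" "snd h \<in> vecs Y" if "h \<in> ?H ` space M" for h
      using that F G by (auto simp: csimple_def)
    have "simple_tensor (\<lambda>\<omega>. cdiff (F \<omega>) (G \<omega>)) B = (\<Sum>h\<in>?S. ?b h (cdiff (fst h) (snd h)))"
      by (rule simple_tensor_partition[OF sf fin]) (auto simp: cdiff_zero_zero mem cdiff_mem B)
    also have "\<dots> = (\<Sum>h\<in>?S. ?b h (fst h) - ?b h (snd h))"
    proof (rule sum.cong)
      fix h
      assume h: "h \<in> ?S"
      have "L1_class M (indicator (fiber ?H h)) \<in> vecs X"
        using h by (intro L1_class_mem integrable_indicator_fiber[OF sf fin]) auto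
      moreover have "fst h \<in> vecs Y" "snd h \<in> vecs Y"
        using mem h by auto
      ultimately show "?b h (cdiff (fst h) (snd h)) = ?b h (fst h) - ?b h (snd h)"
        using B scale_mem[of "snd h" "- 1"] unfolding cdiff_def bilinear_form_def by simp
    qed simp
    also have "\<dots> = (\<Sum>h\<in>?S. ?b h (fst h)) - (\<Sum>h\<in>?S. ?b h (snd h))"
      by (rule sum_subtractf)
    also have "(\<Sum>h\<in>?S. ?b h (fst h)) = simple_tensor F B"
      by (rule simple_tensor_partition[OF sf fin, symmetric]) (auto simp: mem B)
    also have "(\<Sum>h\<in>?S. ?b h (snd h)) = simple_tensor G B"
      by (rule simple_tensor_partition[OF sf fin, symmetric]) (auto simp: mem B)
    finally show ?thesis
      by simp
  qed (simp add: simple_tensor_def)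
qed

text \<open>Lists each non-zero value once, next to the indicator of its fiber. The cost of this
  list will turn out to be the projective norm, so it is an optimal representation.\<close>

lemma simple_tensor_list:
  assumes F: "csimple F"
  obtains zs where "set zs \<subseteq> vecs X \<times> vecs Y" "tensor_of X Y zs = simple_tensor F"
    "tensor_weight X Y zs = (\<integral>\<omega>. vnorm Y (F \<omega>) \<partial>M)"
proof -
  define S where "S = F ` space M - {vzero Y}"
  have "finite S"
    using F by (auto simp: S_def csimple_def dest: simple_functionD)
  then obtain ys where ys: "distinct ys" "set ys = S"
    using finite_distinct_list by blast
  have int: "integrable M (indicator (fiber F y) :: 'w \<Rightarrow> real)" if "y \<in> S" for y
    using F that by (intro integrable_indicator_fiber) (auto simp: csimple_def S_def)
  define zs where "zs = map (\<lambda>y. (L1_class M (indicator (fiber F y)), y)) ys"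
  show ?thesis
  proof
    show "set zs \<subseteq> vecs X \<times> vecs Y"
      using F ys int by (auto simp: zs_def L1_class_mem S_def csimple_def)
    show "tensor_of X Y zs = simple_tensor F"
    proof
      fix B
      show "tensor_of X Y zs B = simple_tensor F B"
      proof (cases "bilinear_form X Y B")
        case True
        then show ?thesis
          by (simp add: tensor_of_bilinear simple_tensor_def zs_def comp_def
              sum_list_distinct_conv_sum_set ys flip: S_def)
      qed (simp add: tensor_of_not_bilinear simple_tensor_def)
    qed
    have "tensor_weight X Y zs = (\<Sum>y\<in>S. vnorm X (L1_class M (indicator (fiber F y))) * vnorm Y y)"
      by (simp add: tensor_weight_def zs_def comp_def sum_list_distinct_conv_sum_set ys)
    also have "\<dots> = (\<Sum>y\<in>S. vnorm Y y * measure M (fiber F y))"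
    proof (intro sum.cong)
      fix y
      assume "y \<in> S"
      moreover have "fiber F y \<inter> space M = fiber F y"
        by (auto simp: fiber_def)
      ultimately show "vnorm X (L1_class M (indicator (fiber F y))) * vnorm Y y = vnorm Y y * measure M (fiber F y)"
        by (simp add: vnorm_L1_class int)
    qed simp
    also have "\<dots> = (\<integral>\<omega>. vnorm Y (F \<omega>) \<partial>M)"
      unfolding S_def by (rule integrable_csimple(2)[where \<psi> = "vnorm Y", OF F norm_zero, symmetric])
    finally show "tensor_weight X Y zs = (\<integral>\<omega>. vnorm Y (F \<omega>) \<partial>M)" .
  qed
qed

lemma simple_tensor_mem: "csimple F \<Longrightarrow> simple_tensor F \<in> vecs V"
  by (metis simple_tensor_list ten.tensor_of_mem)

end

text \<open>Bochner integrability is defined by simple functions that approximate in the integral of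
  the distance; a late enough member of such a sequence serves.\<close>

lemma L1_simple_approx:
  fixes f :: "'a \<Rightarrow> real"
  assumes f: "integrable M f" and e: "0 < e"
  shows "\<exists>h. simple_function M h \<and> emeasure M {x \<in> space M. h x \<noteq> 0} < \<infinity> \<and> integrable M h \<and>
     (\<integral>x. \<bar>f x - h x\<bar> \<partial>M) < e"
proof -
  from f obtain r where "has_bochner_integral M f r"
    by (auto simp: integrable.simps)
  then obtain s where s: "\<And>i. Bochner_Integration.simple_bochner_integrable M (s i)"
      and lim: "(\<lambda>i. \<integral>\<^sup>+x. ennreal (norm (f x - s i x)) \<partial>M) \<longlonglongrightarrow> 0"
    by (elim has_bochner_integral.cases) blast
  from order_tendstoD(2)[OF lim, of "ennreal e"] e
  obtain i where i: "(\<integral>\<^sup>+x. ennreal (norm (f x - s i x)) \<partial>M) < ennreal e"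
    by (auto simp: eventually_sequentially)
  have "simple_function M (s i)" "emeasure M {x \<in> space M. s i x \<noteq> 0} < \<infinity>"
    using s[of i] by (auto elim: simple_bochner_integrable.cases simp: less_top)
  moreover have int: "integrable M (s i)"
    by (rule integrableI_simple_bochner_integrable[OF s])
  moreover have "(\<integral>x. \<bar>f x - s i x\<bar> \<partial>M) < e"
  proof -
    have "(\<integral>\<^sup>+x. ennreal (norm (f x - s i x)) \<partial>M) = ennreal (\<integral>x. \<bar>f x - s i x\<bar> \<partial>M)"
      using f int by (subst nn_integral_eq_integral) auto
    with i show ?thesis
      by (simp add: ennreal_less_iff)
  qed
  ultimately show ?thesis
    by blast
qed

section \<open>The projective norm of simple tensors and their density\<close>

context L1_tensor_C
begin

text \<open>Duality: \<open>B\<close> is a bilinear form bounded by the product of the norms, so its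
  value at a tensor is at most the cost of any representing list. At the tensor of \<open>F\<close>
  its value is the integral of the norms.\<close>

lemma norm_simple_tensor_ge:
  assumes F: "csimple F"
  shows "(\<integral>\<omega>. vnorm Y (F \<omega>) \<partial>M) \<le> vnorm V (simple_tensor F)"
proof (rule ten.norm_ge[OF simple_tensor_mem[OF F]])
  fix zs
  assume zs: "set zs \<subseteq> vecs X \<times> vecs Y" "simple_tensor F = tensor_of X Y zs"
  obtain k where k: "\<And>y. \<lbrakk>y \<in> vecs Y; y \<noteq> vzero Y\<rbrakk> \<Longrightarrow> k y \<in> topspace K \<and> \<bar>y (k y)\<bar> = vnorm Y y"
    using norm_attained by metis
  \<comment> \<open>For non-zero \<open>y\<close> this is a functional in \<open>g\<close> of norm
    at most 1 that takes the norm of \<open>y\<close> as its value at \<open>y\<close>. The default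
    0 at the zero function makes its composition with \<open>F\<close> integrable.\<close>
  define \<psi> where "\<psi> g y = (if y \<in> vecs Y \<and> y \<noteq> vzero Y then sgn (y (k y)) * g (k y) else 0)" for g y
  \<comment> \<open>Elements of \<open>L1_space M\<close> are classes, so a representative is
    chosen; \<open>B_class\<close> shows that the choice does not matter.\<close>
  define B where "B a g = (\<integral>\<omega>. (SOME f. f \<in> a) \<omega> * \<psi> g (F \<omega>) \<partial>M)" for a g
  have \<psi>_meas: "(\<lambda>\<omega>. \<psi> g (F \<omega>)) \<in> borel_measurable M" for g
    by (rule borel_measurable_integrable[OF integrable_csimple(1)[OF F]]) (simp add: \<psi>_def)
  have \<psi>_le: "\<bar>\<psi> g y\<bar> \<le> vnorm Y g" if "g \<in> vecs Y" for g y
    using that k abs_le_norm[OF that, of "k y"] norm_nonneg[OF that]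
    by (auto simp: \<psi>_def abs_mult abs_sgn_eq)
  have int: "integrable M (\<lambda>\<omega>. f \<omega> * \<psi> g (F \<omega>))" if f: "integrable M f" and g: "g \<in> vecs Y" for f g
  proof (rule Bochner_Integration.integrable_bound)
    show "integrable M (\<lambda>\<omega>. f \<omega> * vnorm Y g)"
      using f by simp
    show "(\<lambda>\<omega>. f \<omega> * \<psi> g (F \<omega>)) \<in> borel_measurable M"
      using f \<psi>_meas by (intro borel_measurable_times) auto
    show "AE \<omega> in M. norm (f \<omega> * \<psi> g (F \<omega>)) \<le> norm (f \<omega> * vnorm Y g)"
      using \<psi>_le[OF g] norm_nonneg[OF g] by (auto simp: abs_mult intro!: mult_left_mono)
  qed
  have B_class: "B (L1_class M f) g = (\<integral>\<omega>. f \<omega> * \<psi> g (F \<omega>) \<partial>M)"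
    if f: "integrable M f" for f g
  proof -
    have "f \<in> L1_class M f"
      using f by (simp add: mem_L1_class)
    then have "(SOME h. h \<in> L1_class M f) \<in> L1_class M f"
      by (rule someI[of "\<lambda>h. h \<in> L1_class M f"])
    then have h: "integrable M (SOME h. h \<in> L1_class M f)"
        "AE \<omega> in M. f \<omega> = (SOME h. h \<in> L1_class M f) \<omega>"
      by (auto simp: mem_L1_class)
    show ?thesis
      unfolding B_def
    proof (rule integral_cong_AE)
      show "(\<lambda>\<omega>. (SOME h. h \<in> L1_class M f) \<omega> * \<psi> g (F \<omega>)) \<in> borel_measurable M"
        "(\<lambda>\<omega>. f \<omega> * \<psi> g (F \<omega>)) \<in> borel_measurable M"
        using f h(1) \<psi>_meas by (auto intro!: borel_measurable_times)
      show "AE \<omega> in M. (SOME h. h \<in> L1_class M f) \<omega> * \<psi> g (F \<omega>) = f \<omega> * \<psi> g (F \<omega>)"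
        using h(2) by eventually_elim simp
    qed
  qed
  have \<psi>_add: "\<psi> (vadd Y g g') y = \<psi> g y + \<psi> g' y" and \<psi>_scale: "\<psi> (vscale Y c g) y = c * \<psi> g y"
    for g g' c y
    using k[of y] by (auto simp: \<psi>_def C_space_ops distrib_left)
  have B_bilinear: "bilinear_form X Y B"
    unfolding bilinear_form_def
  proof (intro conjI ballI allI)
    fix a a' g
    assume "a \<in> vecs X" "a' \<in> vecs X" and g: "g \<in> vecs Y"
    then obtain f f' where "integrable M f" "a = L1_class M f" "integrable M f'" "a' = L1_class M f'"
      by (elim vecs_L1E)
    then show "B (vadd X a a') g = B a g + B a' g"
      using g by (simp add: vadd_L1_class B_class distrib_right int)
  next
    fix c a g
    assume "a \<in> vecs X" and g: "g \<in> vecs Y"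
    then obtain f where "integrable M f" "a = L1_class M f"
      by (elim vecs_L1E)
    then show "B (vscale X c a) g = c * B a g"
      using g by (simp add: vscale_L1_class B_class mult.assoc)
  next
    fix a g g'
    assume "a \<in> vecs X" and g: "g \<in> vecs Y" "g' \<in> vecs Y"
    then obtain f where "integrable M f" "a = L1_class M f"
      by (elim vecs_L1E)
    then show "B a (vadd Y g g') = B a g + B a g'"
      using g by (simp add: B_class \<psi>_add distrib_left int)
  next
    fix c a g
    assume "a \<in> vecs X" and g: "g \<in> vecs Y"
    then obtain f where "integrable M f" "a = L1_class M f"
      by (elim vecs_L1E)
    then show "B a (vscale Y c g) = c * B a g"
      using g by (simp add: B_class \<psi>_scale mult.left_commute)
  qed
  have B_le: "\<bar>B a g\<bar> \<le> vnorm X a * vnorm Y g" if a: "a \<in> vecs X" and g: "g \<in> vecs Y" for a g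
  proof -
    obtain f where f: "integrable M f" "a = L1_class M f"
      using a by (elim vecs_L1E)
    have "\<bar>B a g\<bar> \<le> (\<integral>\<omega>. \<bar>f \<omega> * \<psi> g (F \<omega>)\<bar> \<partial>M)"
      unfolding f(2) B_class[OF f(1)] by (rule integral_abs_bound)
    also have "\<dots> \<le> (\<integral>\<omega>. \<bar>f \<omega>\<bar> * vnorm Y g \<partial>M)"
    proof (rule integral_mono)
      show "integrable M (\<lambda>\<omega>. \<bar>f \<omega> * \<psi> g (F \<omega>)\<bar>)"
        by (rule integrable_abs[OF int[OF f(1) g]])
      show "integrable M (\<lambda>\<omega>. \<bar>f \<omega>\<bar> * vnorm Y g)"
        using f(1) by simp
      show "\<bar>f \<omega> * \<psi> g (F \<omega>)\<bar> \<le> \<bar>f \<omega>\<bar> * vnorm Y g" for \<omega>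
        by (simp add: abs_mult mult_left_mono \<psi>_le[OF g])
    qed
    finally show ?thesis
      by (simp add: f vnorm_L1_class)
  qed
  have "(\<integral>\<omega>. vnorm Y (F \<omega>) \<partial>M) = (\<Sum>y\<in>F ` space M - {vzero Y}. vnorm Y y * measure M (fiber F y))"
    by (rule integrable_csimple(2)[where \<psi> = "vnorm Y", OF F norm_zero])
  also have "\<dots> = (\<Sum>y\<in>F ` space M - {vzero Y}. B (L1_class M (indicator (fiber F y))) y)"
  proof (rule sum.cong)
    fix y
    assume y: "y \<in> F ` space M - {vzero Y}"
    have yY: "y \<in> vecs Y" "y \<noteq> vzero Y"
      using y F by (auto simp: csimple_def)
    have int_y: "integrable M (indicator (fiber F y) :: 'w \<Rightarrow> real)"
      using F yY by (intro integrable_indicator_fiber) (auto simp: csimple_def)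
    have "B (L1_class M (indicator (fiber F y))) y = (\<integral>\<omega>. indicator (fiber F y) \<omega> * \<psi> y (F \<omega>) \<partial>M)"
      by (rule B_class[OF int_y])
    also have "\<dots> = (\<integral>\<omega>. vnorm Y y * indicator (fiber F y) \<omega> \<partial>M)"
      using k[OF yY] yY
      by (intro Bochner_Integration.integral_cong)
         (auto simp: fiber_def \<psi>_def indicator_def abs_sgn mult.commute)
    also have "\<dots> = vnorm Y y * measure M (fiber F y \<inter> space M)"
      by simp
    also have "fiber F y \<inter> space M = fiber F y"
      by (auto simp: fiber_def)
    finally show "vnorm Y y * measure M (fiber F y) = B (L1_class M (indicator (fiber F y))) y"
      by simp
  qed simp
  also have "\<dots> = simple_tensor F B"
    using B_bilinear by (simp add: simple_tensor_def)
  also have "\<dots> = (\<Sum>(x, y)\<leftarrow>zs. B x y)"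
    using B_bilinear by (simp add: zs(2) tensor_of_bilinear)
  also have "\<dots> \<le> tensor_weight X Y zs"
    using zs(1)
  proof (induction zs)
    case (Cons z zs)
    then show ?case
      using B_le[of "fst z" "snd z"] by (auto simp: case_prod_beta)
  qed simp
  finally show "(\<integral>\<omega>. vnorm Y (F \<omega>) \<partial>M) \<le> tensor_weight X Y zs" .
qed

lemma norm_simple_tensor:
  assumes F: "csimple F"
  shows "vnorm V (simple_tensor F) = (\<integral>\<omega>. vnorm Y (F \<omega>) \<partial>M)"
proof (rule antisym[OF _ norm_simple_tensor_ge[OF F]])
  obtain zs where "set zs \<subseteq> vecs X \<times> vecs Y" "tensor_of X Y zs = simple_tensor F"
    "tensor_weight X Y zs = (\<integral>\<omega>. vnorm Y (F \<omega>) \<partial>M)"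
    by (rule simple_tensor_list[OF F])
  then show "vnorm V (simple_tensor F) \<le> (\<integral>\<omega>. vnorm Y (F \<omega>) \<partial>M)"
    using ten.norm_tensor_of_le by metis
qed

text \<open>On the fiber over \<open>c\<close> the scalar \<open>c\<close> moves from the second
  factor to the first, where the terms add up to \<open>h\<close>. This brings pure tensors with a
  simple first factor among the simple tensors.\<close>

lemma simple_tensor_scaled:
  assumes h: "simple_function M h" "emeasure M {\<omega> \<in> space M. h \<omega> \<noteq> 0} < \<infinity>" "integrable M h"
    and g: "g \<in> vecs Y"
  shows "csimple (\<lambda>\<omega>. vscale Y (h \<omega>) g)"
    and "simple_tensor (\<lambda>\<omega>. vscale Y (h \<omega>) g) = pure_tensor X Y (L1_class M h) g"
proof -
  have zero: "vscale Y 0 g = vzero Y"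
    by (simp add: C_space_ops)
  have "emeasure M {\<omega> \<in> space M. vscale Y (h \<omega>) g \<noteq> vzero Y} \<le> emeasure M {\<omega> \<in> space M. h \<omega> \<noteq> 0}"
  proof (rule emeasure_mono)
    have "{\<omega> \<in> space M. h \<omega> \<noteq> 0} = h -` (- {0}) \<inter> space M"
      by auto
    then show "{\<omega> \<in> space M. h \<omega> \<noteq> 0} \<in> sets M"
      using simple_functionD[OF h(1)] by metis
  qed (auto simp: zero)
  then show "csimple (\<lambda>\<omega>. vscale Y (h \<omega>) g)"
    using h g unfolding csimple_def
    by (auto simp: scale_mem le_less_trans simple_function_compose1[where g = "\<lambda>c. vscale Y c g"])
  show "simple_tensor (\<lambda>\<omega>. vscale Y (h \<omega>) g) = pure_tensor X Y (L1_class M h) g"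
  proof
    fix B
    show "simple_tensor (\<lambda>\<omega>. vscale Y (h \<omega>) g) B = pure_tensor X Y (L1_class M h) g B"
    proof (cases "bilinear_form X Y B")
      case B: True
      let ?S = "h ` space M - {0}"
      have S: "finite ?S"
        using simple_functionD(1)[OF h(1)] by simp
      have int: "integrable M (indicator (fiber h c) :: 'w \<Rightarrow> real)" if "c \<in> ?S" for c
        using that by (intro integrable_indicator_fiber[OF h(1,2)]) auto
      have "simple_tensor (\<lambda>\<omega>. vscale Y (h \<omega>) g) B =
          (\<Sum>c\<in>?S. B (L1_class M (indicator (fiber h c))) (vscale Y c g))"
        by (rule simple_tensor_partition[OF h(1,2)]) (auto simp: zero scale_mem g B)
      also have "\<dots> = (\<Sum>c\<in>?S. B (L1_class M (\<lambda>\<omega>. c * indicator (fiber h c) \<omega>)) g)"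
      proof (rule sum.cong)
        fix c
        assume c: "c \<in> ?S"
        have "B (L1_class M (indicator (fiber h c))) (vscale Y c g) = c * B (L1_class M (indicator (fiber h c))) g"
          using B g L1_class_mem[OF int[OF c]] by (simp add: bilinear_form_def)
        also have "\<dots> = B (L1_class M (\<lambda>\<omega>. c * indicator (fiber h c) \<omega>)) g"
          by (rule bilinear_L1_scale[OF B g int[OF c], symmetric])
        finally show "B (L1_class M (indicator (fiber h c))) (vscale Y c g) =
            B (L1_class M (\<lambda>\<omega>. c * indicator (fiber h c) \<omega>)) g" .
      qed simp
      also have "\<dots> = B (L1_class M (\<lambda>\<omega>. \<Sum>c\<in>?S. c * indicator (fiber h c) \<omega>)) g"
        using int by (intro bilinear_L1_sum[OF B g, symmetric]) simp
      also have "L1_class M (\<lambda>\<omega>. \<Sum>c\<in>?S. c * indicator (fiber h c) \<omega>) = L1_class M h"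
      proof (rule L1_class_cong)
        show "integrable M (\<lambda>\<omega>. \<Sum>c\<in>?S. c * indicator (fiber h c) \<omega>)"
          by (intro Bochner_Integration.integrable_sum integrable_mult_right int)
        have "(\<Sum>c\<in>?S. c * indicator (fiber h c) \<omega>) = h \<omega>" if "\<omega> \<in> space M" for \<omega>
        proof -
          have "(\<Sum>c\<in>?S. c * indicator (fiber h c) \<omega>) = (\<Sum>c\<in>?S. if c = h \<omega> then h \<omega> else 0)"
            using that by (intro sum.cong) (auto simp: fiber_def indicator_def)
          then show ?thesis
            using S that by auto
        qed
        then show "AE \<omega> in M. (\<Sum>c\<in>?S. c * indicator (fiber h c) \<omega>) = h \<omega>"
          by simp
      qed (rule h(3))
      finally show ?thesis
        using B by (simp add: pure_tensor_def)
    qed (simp add: simple_tensor_def pure_tensor_def)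
  qed
qed

text \<open>Replacing the first factor \<open>f\<close> by a simple \<open>h\<close> changes the
  tensor by the class of \<open>f - h\<close> tensored with \<open>g\<close>, whose norm is at most
  the product of the factors' norms.\<close>

lemma pure_tensor_approx:
  assumes a: "a \<in> vecs X" and g: "g \<in> vecs Y" and e: "0 < e"
  shows "\<exists>F. csimple F \<and> vnorm V (pure_tensor X Y a g - simple_tensor F) < e"
proof -
  obtain f where f: "integrable M f" "a = L1_class M f"
    using a by (rule vecs_L1E)
  \<comment> \<open>Adding 1 keeps the denominator positive when \<open>g\<close> has norm
    zero.\<close>
  define e' where "e' = e / (vnorm Y g + 1)"
  have g_pos: "0 < vnorm Y g + 1"
    using norm_nonneg[OF g] by simp
  then have "0 < e'"
    using e by (simp add: e'_def)
  then obtain h where h: "simple_function M h" "emeasure M {x \<in> space M. h x \<noteq> 0} < \<infinity>" "integrable M h"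
    and fh: "(\<integral>x. \<bar>f x - h x\<bar> \<partial>M) < e'"
    using L1_simple_approx[OF f(1)] by blast
  let ?d = "L1_class M (\<lambda>x. f x - h x)"
  have d: "?d \<in> vecs X"
    using f h by (intro L1_class_mem) auto
  have "pure_tensor X Y a g - pure_tensor X Y (L1_class M h) g = pure_tensor X Y ?d g"
  proof
    fix B
    have "a = vadd X (L1_class M h) ?d"
      using f h by (simp add: vadd_L1_class)
    then show "(pure_tensor X Y a g - pure_tensor X Y (L1_class M h) g) B = pure_tensor X Y ?d g B"
      using d g L1_class_mem[OF h(3)] by (auto simp: pure_tensor_def bilinear_form_def)
  qed
  moreover have "vnorm V (pure_tensor X Y ?d g) \<le> vnorm X ?d * vnorm Y g"
    using ten.norm_tensor_of_le[of "[(?d, g)]"] d g by (simp add: tensor_of_Cons tensor_of_Nil)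
  moreover have "vnorm X ?d * vnorm Y g < e"
  proof -
    have "vnorm X ?d * vnorm Y g \<le> e' * vnorm Y g"
      using f h fh norm_nonneg[OF g] by (intro mult_right_mono) (auto simp: vnorm_L1_class)
    also have "\<dots> < e' * (vnorm Y g + 1)"
      using \<open>0 < e'\<close> by simp
    also have "\<dots> = e"
      using g_pos by (simp add: e'_def)
    finally show ?thesis .
  qed
  ultimately have "vnorm V (pure_tensor X Y a g - simple_tensor (\<lambda>\<omega>. vscale Y (h \<omega>) g)) < e"
    by (simp only: simple_tensor_scaled(2)[OF h g])
  then show ?thesis
    using simple_tensor_scaled(1)[OF h g] by blast
qed

lemma simple_tensor_dense:
  assumes u: "u \<in> vecs V" and e: "0 < e"
  shows "\<exists>F. csimple F \<and> vnorm V (u - simple_tensor F) < e"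
proof -
  \<comment> \<open>The approximable tensors. They are closed under differences and contain the pure
    tensors, hence contain every finite sum of these.\<close>
  define A where "A = {u \<in> vecs V. \<forall>e>0. \<exists>F. csimple F \<and> vnorm V (u - simple_tensor F) < e}"
  have diff: "u - v \<in> A" if "u \<in> A" "v \<in> A" for u v
  proof -
    have uv: "u \<in> vecs V" "v \<in> vecs V"
      using that by (auto simp: A_def)
    have "\<exists>F. csimple F \<and> vnorm V (u - v - simple_tensor F) < e" if "0 < e" for e
    proof -
      have "0 < e / 2"
        using that by simp
      then obtain F G where FG: "csimple F" "vnorm V (u - simple_tensor F) < e / 2"
          "csimple G" "vnorm V (v - simple_tensor G) < e / 2"
        using \<open>u \<in> A\<close> \<open>v \<in> A\<close> unfolding A_def by blast
      let ?H = "\<lambda>\<omega>. cdiff (F \<omega>) (G \<omega>)"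
      have mem: "u - simple_tensor F \<in> vecs V" "v - simple_tensor G \<in> vecs V"
        using uv FG by (auto intro: ten.alg.diff_mem simple_tensor_mem)
      have "u - v - simple_tensor ?H = (u - simple_tensor F) + - (v - simple_tensor G)"
        by (simp add: simple_tensor_diff FG algebra_simps)
      moreover have "vnorm V ((u - simple_tensor F) + - (v - simple_tensor G)) \<le>
          vnorm V (u - simple_tensor F) + vnorm V (- (v - simple_tensor G))"
        by (intro ten.alg.norm_triangle ten.alg.minus_mem mem)
      ultimately have "vnorm V (u - v - simple_tensor ?H) < e"
        using FG ten.alg.norm_minus[OF mem(2)] by (simp only:)
      then show ?thesis
        using csimple_diff FG by blast
    qed
    then show ?thesis
      using uv by (auto simp: A_def ten.alg.diff_mem)
  qed
  have pure: "pure_tensor X Y a g \<in> A" if "a \<in> vecs X" "g \<in> vecs Y" for a g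
    using that pure_tensor_approx ten.pure_tensor_mem by (auto simp: A_def)
  obtain zs where zs: "set zs \<subseteq> vecs X \<times> vecs Y" "u = tensor_of X Y zs"
    using u by (auto simp: ten.vecs_alg_tensor)
  have "tensor_of X Y zs \<in> A"
    using zs(1)
  proof (induction zs)
    case Nil
    show ?case
      using diff[OF pure pure, OF ten.X.vzero_mem zero_mem ten.X.vzero_mem zero_mem]
      by (simp only: tensor_of_Nil diff_self)
  next
    case (Cons z zs)
    have "pure_tensor X Y (fst z) (snd z) \<in> A"
      using Cons.prems by (intro pure) auto
    moreover from this have "pure_tensor X Y (fst z) (snd z) - pure_tensor X Y (fst z) (snd z) \<in> A"
      by (intro diff)
    \<comment> \<open>Closure under differences yields sums by subtracting a negative; zero enters
      as a difference of equal elements.\<close>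
    ultimately have "pure_tensor X Y (fst z) (snd z) - (0 - tensor_of X Y zs) \<in> A"
      using Cons by (intro diff) auto
    then show ?case
      by (simp only: tensor_of_Cons diff_0 diff_minus_eq_add)
  qed
  then show ?thesis
    using zs(2) e by (simp add: A_def)
qed

end

section \<open>Splitting off an elementary part\<close>

context stone_space_functions
begin

text \<open>Here \<open>w\<close> is \<open>N / 5\<close> times a sign function of
  \<open>y0\<close>, where \<open>N\<close> is the norm of \<open>y0\<close>. If \<open>t N\<close>
  is used as sign threshold, as allowed distance and as norm of \<open>w\<close>, then a
  \<open>y\<close> with the wrong sign is still above \<open>- 2 t N\<close>, and the estimate needs
  this to be at least \<open>2 t N - (1 - t) N\<close>. The largest such \<open>t\<close> is
  1/5.\<close>

lemma exists_common_summand: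
  assumes y0: "y0 \<in> vecs Y"
  shows "\<exists>w\<in>vecs Y. (y0 = vzero Y \<longrightarrow> w = vzero Y) \<and> 5 * vnorm Y w = vnorm Y y0 \<and>
    (\<forall>y\<in>vecs Y. 5 * vnorm Y (cdiff y y0) \<le> vnorm Y y0 \<longrightarrow> vnorm Y (cdiff y w) \<le> vnorm Y y - vnorm Y w)"
proof (cases "y0 = vzero Y")
  case True
  then show ?thesis
    using zero_mem norm_zero by (intro bexI[of _ "vzero Y"]) (auto simp: cdiff_zero)
next
  case False
  define N where "N = vnorm Y y0"
  have N: "0 < N"
    using False norm_nonneg[OF y0] norm_eq_0_iff[OF y0] by (simp add: N_def)
  obtain x0 where x0: "x0 \<in> topspace K" "\<bar>y0 x0\<bar> = N"
    using norm_attained[OF y0 False] by (auto simp: N_def)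
  obtain e where e: "e \<in> vecs Y" and e_sign: "\<And>x. x \<in> topspace K \<Longrightarrow>
      (e x = 1 \<or> e x = - 1) \<and> (N / 5 \<le> y0 x \<longrightarrow> e x = 1) \<and> (y0 x \<le> - (N / 5) \<longrightarrow> e x = - 1)"
    using sign_function[OF y0, of "N / 5"] N by auto
  have abs_e: "\<bar>e x\<bar> = 1" if "x \<in> topspace K" for x
    using e_sign[OF that] by auto
  have norm_e: "vnorm Y e = 1"
    using abs_le_norm[OF e x0(1)] abs_e x0(1) by (intro antisym norm_le) auto
  define w where "w = vscale Y (N / 5) e"
  have w: "w \<in> vecs Y" and norm_w: "vnorm Y w = N / 5"
    using e N by (simp_all add: w_def scale_mem norm_scale norm_e)
  have "vnorm Y (cdiff y w) \<le> vnorm Y y - vnorm Y w"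
    if y: "y \<in> vecs Y" and close: "5 * vnorm Y (cdiff y y0) \<le> N" for y
  proof (rule norm_le)
    have near: "\<bar>y x - y0 x\<bar> \<le> N / 5" if "x \<in> topspace K" for x
      using abs_le_norm[OF cdiff_mem[OF y y0] that] close that by (simp add: cdiff_apply)
    have large: "4 * N / 5 \<le> vnorm Y y"
      using near[OF x0(1)] x0(2) abs_le_norm[OF y x0(1)] by linarith
    then show "0 \<le> vnorm Y y - vnorm Y w"
      using N by (simp add: norm_w)
    fix x
    assume x: "x \<in> topspace K"
    have eq: "cdiff y w x = y x - N / 5 * e x"
      using x by (simp add: cdiff_apply w_def C_space_ops)
    have bounds: "- (N / 5) \<le> y x - y0 x" "y x - y0 x \<le> N / 5" "y x \<le> vnorm Y y" "- vnorm Y y \<le> y x"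
      using near[OF x] abs_le_norm[OF y x] by linarith+
    \<comment> \<open>In the first case \<open>y x\<close> exceeds \<open>- 2 N / 5\<close>, which
      by \<open>large\<close> is at least \<open>2 N / 5\<close> minus the norm of \<open>y\<close>;
      this is the lower estimate. The second case is symmetric.\<close>
    consider "e x = 1" "- (N / 5) < y0 x" | "e x = - 1" "y0 x < N / 5"
      using e_sign[OF x] by fastforce
    then show "\<bar>cdiff y w x\<bar> \<le> vnorm Y y - vnorm Y w"
      unfolding eq norm_w abs_le_iff by cases (use bounds large in auto)
  qed
  moreover have "5 * vnorm Y w = vnorm Y y0"
    by (simp add: norm_w N_def)
  ultimately show ?thesis
    using w False unfolding N_def by blast
qed

end

section \<open>Splitting the limit of a sequence of simple tensors\<close>

locale L1_tensor_stone = L1_tensor_C K M + stone_space_functions K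
  for K :: "'k topology" and M :: "'w measure"
begin

lemma nn_integral_csimple:
  assumes "csimple F"
  shows "(\<integral>\<^sup>+\<omega>. ennreal (vnorm Y (F \<omega>)) \<partial>M) = ennreal (vnorm V (simple_tensor F))"
  using assms norm_nonneg
  by (subst nn_integral_eq_integral[OF integrable_norm_csimple])
     (auto simp: norm_simple_tensor csimple_def)

lemma csimple_mem: "\<lbrakk>csimple F; \<omega> \<in> space M\<rbrakk> \<Longrightarrow> F \<omega> \<in> vecs Y"
  by (simp add: csimple_def)

lemma norm_measurable: "csimple F \<Longrightarrow> (\<lambda>\<omega>. vnorm Y (F \<omega>)) \<in> borel_measurable M"
  by (rule borel_measurable_integrable[OF integrable_norm_csimple])

text \<open>Supplies the hypothesis \<open>split\<close> of \<open>NA_proj_eqI\<close> with the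
  constant 1/10.\<close>

lemma exists_split:
  assumes s: "s \<in> cauchy_seqs V" and l_pos: "0 < lim (\<lambda>n. vnorm V (s n))"
  shows "\<exists>zs. set zs \<subseteq> vecs X \<times> vecs Y \<and>
    lim (\<lambda>n. vnorm V (s n - tensor_of X Y zs)) \<le> lim (\<lambda>n. vnorm V (s n)) - tensor_weight X Y zs \<and>
    1 / 10 * lim (\<lambda>n. vnorm V (s n)) \<le> tensor_weight X Y zs"
proof -
  define l where "l = lim (\<lambda>n. vnorm V (s n))"
  \<comment> \<open>The estimates below give \<open>l \<le> 5 * vnorm V v + 6 * \<epsilon>\<close>;
    with this choice the error is half of \<open>l\<close>, which leaves \<open>l / 10\<close> for
    the norm of \<open>v\<close>.\<close>
  define \<epsilon> where "\<epsilon> = l / 12"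
  have \<epsilon>: "0 < \<epsilon>"
    using l_pos by (simp add: \<epsilon>_def l_def)
  \<comment> \<open>The exponent \<open>n + 2\<close> makes
    \<open>\<delta> n + \<delta> (Suc n)\<close> at most
    \<open>\<epsilon> * (1 / 2) ^ Suc n\<close>, and these bounds add up to \<epsilon>.\<close>
  define \<delta> where "\<delta> n = \<epsilon> / 2 ^ (n + 2)" for n :: nat
  have \<delta>: "0 < \<delta> n" for n
    using \<epsilon> by (simp add: \<delta>_def)
  have "\<exists>F. csimple F \<and> (\<exists>N. \<forall>m\<ge>N. vnorm V (s m - simple_tensor F) \<le> \<delta> n)" for n
  proof -
    have "0 < \<delta> n / 2"
      using \<delta>[of n] by simp
    then obtain N where N: "\<And>m. m \<ge> N \<Longrightarrow> vnorm V (s m - s N) < \<delta> n / 2"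
      using s unfolding ten.alg.cauchy_seqs_iff by (meson order_refl)
    obtain F where F: "csimple F" "vnorm V (s N - simple_tensor F) < \<delta> n / 2"
      using simple_tensor_dense[OF ten.alg.cauchy_memD[OF s] \<open>0 < \<delta> n / 2\<close>] by blast
    have "vnorm V (s m - simple_tensor F) \<le> \<delta> n" if "m \<ge> N" for m
      using ten.alg.norm_triangle_diff[OF ten.alg.cauchy_memD[OF s, of m] ten.alg.cauchy_memD[OF s, of N]
          simple_tensor_mem[OF F(1)]] N[OF that] F(2) by linarith
    then show ?thesis
      using F(1) by blast
  qed
  then obtain F where F: "\<And>n. csimple (F n)"
    and F_approx: "\<And>n. \<exists>N. \<forall>m\<ge>N. vnorm V (s m - simple_tensor (F n)) \<le> \<delta> n"
    by metis
  define t where "t n = simple_tensor (F n)" for n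
  have t_mem: "t n \<in> vecs V" for n
    by (simp add: t_def simple_tensor_mem F)
  define L where "L v = lim (\<lambda>m. vnorm V (s m - v))" for v
  \<comment> \<open>In the limit \<open>t n\<close> is within \<open>\<delta> n\<close> of the
    represented element, so subtracting the same \<open>v\<close> from both changes neither that
    distance nor the bound, which is uniform in \<open>v\<close>.\<close>
  have L_approx: "\<bar>L v - vnorm V (t n - v)\<bar> \<le> \<delta> n" if v: "v \<in> vecs V" for v n
  proof (rule LIMSEQ_le_const2)
    show "(\<lambda>m. \<bar>vnorm V (s m - v) - vnorm V (t n - v)\<bar>) \<longlonglongrightarrow> \<bar>L v - vnorm V (t n - v)\<bar>"
      unfolding L_def
      by (intro tendsto_intros ten.alg.cauchy_norm_tendsto ten.alg.cauchy_diff_const s v)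
    obtain N where N: "\<forall>m\<ge>N. vnorm V (s m - t n) \<le> \<delta> n"
      using F_approx[of n] by (auto simp: t_def)
    have "\<bar>vnorm V (s m - v) - vnorm V (t n - v)\<bar> \<le> \<delta> n" if "m \<ge> N" for m
    proof -
      have "\<bar>vnorm V (s m - v) - vnorm V (t n - v)\<bar> \<le> vnorm V ((s m - v) - (t n - v))"
        by (intro ten.alg.abs_norm_diff_le ten.alg.diff_mem ten.alg.cauchy_memD[OF s] t_mem v)
      also have "(s m - v) - (t n - v) = s m - t n"
        by simp
      finally show ?thesis
        using N that by (meson order_trans)
    qed
    then show "\<exists>N. \<forall>m\<ge>N. \<bar>vnorm V (s m - v) - vnorm V (t n - v)\<bar> \<le> \<delta> n"
      by blast
  qed
  have \<delta>_lim: "\<delta> \<longlonglongrightarrow> 0"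
  proof -
    have "(\<lambda>n. \<epsilon> / 4 * (1 / 2) ^ n) \<longlonglongrightarrow> 0"
      by (intro tendsto_mult_right_zero LIMSEQ_power_zero) simp
    then show ?thesis
      by (simp add: \<delta>_def[abs_def] power_divide)
  qed
  have L_lim: "(\<lambda>n. vnorm V (t n - v)) \<longlonglongrightarrow> L v" if v: "v \<in> vecs V" for v
  proof -
    have "(\<lambda>n. vnorm V (t n - v) - L v) \<longlonglongrightarrow> 0"
      by (rule Lim_null_comparison[OF _ \<delta>_lim])
         (use L_approx[OF v] in \<open>auto simp: abs_minus_commute\<close>)
    then show ?thesis
      by (rule LIM_zero_cancel)
  qed
  have L_0: "L 0 = l"
    by (simp add: L_def l_def)

  define \<rho> where "\<rho> n \<omega> = vnorm Y (cdiff (F (Suc n) \<omega>) (F n \<omega>))" for n \<omega>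
  have norm_step: "vnorm V (t (Suc n) - t n) \<le> \<epsilon> * (1 / 2) ^ Suc n" for n
  proof -
    have "vnorm V (t (Suc n) - t n) \<le> L (t n) + \<delta> (Suc n)"
      using L_approx[OF t_mem, of n "Suc n"] by linarith
    also have "L (t n) \<le> \<delta> n"
      using L_approx[OF t_mem, of n n] by (simp add: ten.alg.norm_zero)
    also have "\<delta> n + \<delta> (Suc n) \<le> \<epsilon> * (1 / 2) ^ Suc n"
      using \<epsilon> by (simp add: \<delta>_def field_simps)
    finally show ?thesis
      by simp
  qed
  \<comment> \<open>The total variation of the sequence \<open>F n \<omega>\<close> integrates to at
    most \<epsilon>. Extended integrals are used because the series may diverge at some
    points.\<close>
  have \<rho>_sum: "(\<integral>\<^sup>+\<omega>. (\<Sum>n. ennreal (\<rho> n \<omega>)) \<partial>M) \<le> ennreal \<epsilon>"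
  proof -
    have "(\<integral>\<^sup>+\<omega>. (\<Sum>n. ennreal (\<rho> n \<omega>)) \<partial>M) = (\<Sum>n. \<integral>\<^sup>+\<omega>. ennreal (\<rho> n \<omega>) \<partial>M)"
      unfolding \<rho>_def
      by (intro nn_integral_suminf measurable_compose[OF norm_measurable measurable_ennreal] csimple_diff F)
    also have "\<dots> = (\<Sum>n. ennreal (vnorm V (t (Suc n) - t n)))"
      unfolding \<rho>_def by (simp add: nn_integral_csimple csimple_diff simple_tensor_diff F t_def)
    also have "\<dots> \<le> (\<Sum>n. ennreal (\<epsilon> * (1 / 2) ^ Suc n))"
      by (intro suminf_le ennreal_leI norm_step) auto
    also have "\<dots> = ennreal (\<epsilon> * 1)"
      using \<epsilon> by (intro suminf_ennreal_eq sums_mult power_half_series) simp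
    finally show ?thesis
      by simp
  qed

  \<comment> \<open>The points where every \<open>F n \<omega>\<close> is close enough to
    \<open>F 0 \<omega>\<close> for one common summand. Countably many measurable conditions define
    it.\<close>
  define \<Omega> where "\<Omega> = {\<omega> \<in> space M. \<forall>n. 5 * vnorm Y (cdiff (F n \<omega>) (F 0 \<omega>)) \<le> vnorm Y (F 0 \<omega>)}"
  have \<Omega>: "\<Omega> \<in> sets M"
  proof -
    have [measurable]: "(\<lambda>\<omega>. vnorm Y (cdiff (F n \<omega>) (F 0 \<omega>))) \<in> borel_measurable M"
      "(\<lambda>\<omega>. vnorm Y (F 0 \<omega>)) \<in> borel_measurable M" for n
      by (intro norm_measurable csimple_diff F)+
    show ?thesis
      unfolding \<Omega>_def by measurable
  qed
  define P where "P y0 w \<longleftrightarrow> w \<in> vecs Y \<and> (y0 = vzero Y \<longrightarrow> w = vzero Y) \<and> 5 * vnorm Y w = vnorm Y y0 \<and>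
      (\<forall>y\<in>vecs Y. 5 * vnorm Y (cdiff y y0) \<le> vnorm Y y0 \<longrightarrow>
        vnorm Y (cdiff y w) \<le> vnorm Y y - vnorm Y w)" for y0 w
  have ex: "\<forall>y0. \<exists>w. y0 \<in> vecs Y \<longrightarrow> P y0 w"
    unfolding P_def using exists_common_summand by blast
  obtain W where "\<forall>y0. y0 \<in> vecs Y \<longrightarrow> P y0 (W y0)"
    using choice[OF ex] by (rule exE)
  then have W: "W y0 \<in> vecs Y" "y0 = vzero Y \<Longrightarrow> W y0 = vzero Y" "5 * vnorm Y (W y0) = vnorm Y y0"
      "\<lbrakk>y \<in> vecs Y; 5 * vnorm Y (cdiff y y0) \<le> vnorm Y y0\<rbrakk> \<Longrightarrow>
        vnorm Y (cdiff y (W y0)) \<le> vnorm Y y - vnorm Y (W y0)" if "y0 \<in> vecs Y" for y0 y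
    using that by (simp_all only: P_def)
  \<comment> \<open>\<open>G\<close> is determined by membership in \<Omega> and by the value of
    \<open>F 0\<close>, so it is simple again; as \<open>W\<close> preserves zero, its support lies
    in that of \<open>F 0\<close>.\<close>
  define G where "G \<omega> = (if \<omega> \<in> \<Omega> then W (F 0 \<omega>) else vzero Y)" for \<omega>
  have G: "csimple G"
    unfolding csimple_def
  proof (intro conjI ballI)
    define \<phi> where "\<phi> c y = (if c = (1 :: real) then W y else vzero Y)" for c y
    have "G = (\<lambda>\<omega>. \<phi> (indicator \<Omega> \<omega>) (F 0 \<omega>))"
      by (simp add: G_def \<phi>_def fun_eq_iff indicator_def)
    moreover have "simple_function M (F 0)"
      using F[of 0] by (simp add: csimple_def)
    then have "simple_function M (\<lambda>\<omega>. \<phi> (indicator \<Omega> \<omega>) (F 0 \<omega>))"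
      by (rule simple_function_compose2[where h = \<phi>, OF simple_function_indicator[OF \<Omega>]])
    ultimately show "simple_function M G"
      by (simp only:)
    show "G \<omega> \<in> vecs Y" if "\<omega> \<in> space M" for \<omega>
      using W(1)[OF csimple_mem[OF F that]] by (simp add: G_def zero_mem)
    have "emeasure M {\<omega> \<in> space M. G \<omega> \<noteq> vzero Y} \<le> emeasure M {\<omega> \<in> space M. F 0 \<omega> \<noteq> vzero Y}"
    proof (rule emeasure_mono)
      show "{\<omega> \<in> space M. G \<omega> \<noteq> vzero Y} \<subseteq> {\<omega> \<in> space M. F 0 \<omega> \<noteq> vzero Y}"
        using W(2)[OF zero_mem refl] by (auto simp: G_def)
      have "{\<omega> \<in> space M. F 0 \<omega> \<noteq> vzero Y} = F 0 -` (- {vzero Y}) \<inter> space M"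
        by auto
      then show "{\<omega> \<in> space M. F 0 \<omega> \<noteq> vzero Y} \<in> sets M"
        using F[of 0] by (auto simp: csimple_def intro: simple_functionD)
    qed
    also have "\<dots> < \<infinity>"
      using F[of 0] by (simp add: csimple_def)
    finally show "emeasure M {\<omega> \<in> space M. G \<omega> \<noteq> vzero Y} < \<infinity>" .
  qed
  define v where "v = simple_tensor G"
  have v: "v \<in> vecs V"
    by (simp add: v_def simple_tensor_mem G)

  \<comment> \<open>The pointwise inequality, trivial off \<Omega> where \<open>G\<close> vanishes,
    integrates to one between projective norms because these are integrals on simple tensors. It
    then passes to the limit in \<open>n\<close>.\<close>
  have "vnorm V (t n - v) \<le> vnorm V (t n) - vnorm V v" for n
  proof -
    have "vnorm V (t n - v) = (\<integral>\<omega>. vnorm Y (cdiff (F n \<omega>) (G \<omega>)) \<partial>M)"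
      by (simp add: t_def v_def norm_simple_tensor csimple_diff F G flip: simple_tensor_diff)
    also have "\<dots> \<le> (\<integral>\<omega>. vnorm Y (F n \<omega>) - vnorm Y (G \<omega>) \<partial>M)"
    proof (rule integral_mono)
      show "integrable M (\<lambda>\<omega>. vnorm Y (cdiff (F n \<omega>) (G \<omega>)))"
        by (intro integrable_norm_csimple csimple_diff F G)
      show "integrable M (\<lambda>\<omega>. vnorm Y (F n \<omega>) - vnorm Y (G \<omega>))"
        by (intro Bochner_Integration.integrable_diff integrable_norm_csimple F G)
      fix \<omega>
      assume \<omega>: "\<omega> \<in> space M"
      show "vnorm Y (cdiff (F n \<omega>) (G \<omega>)) \<le> vnorm Y (F n \<omega>) - vnorm Y (G \<omega>)"
      proof (cases "\<omega> \<in> \<Omega>")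
        case True
        then show ?thesis
          using W(4)[OF csimple_mem[OF F \<omega>, of 0] csimple_mem[OF F \<omega>, of n]] by (simp add: G_def \<Omega>_def)
      next
        case False
        then show ?thesis
          using csimple_mem[OF F \<omega>, of n] by (simp add: G_def cdiff_zero norm_zero)
      qed
    qed
    also have "\<dots> = vnorm V (t n) - vnorm V v"
      by (simp add: t_def v_def norm_simple_tensor F G integrable_norm_csimple)
    finally show ?thesis .
  qed
  moreover have "(\<lambda>n. vnorm V (t n) - vnorm V v) \<longlonglongrightarrow> l - vnorm V v"
    using L_lim[OF ten.alg.zero_mem] by (intro tendsto_intros) (simp add: L_0)
  ultimately have L_v: "L v \<le> l - vnorm V v"
    using L_lim[OF v] by (intro LIMSEQ_le) auto

  have "ennreal (vnorm V (t 0)) \<le> ennreal (5 * vnorm V v + 5 * \<epsilon>)"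
  proof -
    \<comment> \<open>On \<Omega> the norm of \<open>F 0\<close> is exactly five times that of
      \<open>G\<close>. Off \<Omega> some \<open>F n\<close> has moved away by more than a fifth of
      that norm, so the variation pays for it.\<close>
    have pointwise: "ennreal (vnorm Y (F 0 \<omega>)) \<le> 5 * ennreal (vnorm Y (G \<omega>)) + 5 * (\<Sum>n. ennreal (\<rho> n \<omega>))"
      if \<omega>: "\<omega> \<in> space M" for \<omega>
    proof (cases "\<omega> \<in> \<Omega>")
      case True
      have "vnorm Y (F 0 \<omega>) = 5 * vnorm Y (G \<omega>)"
        using True W(3)[OF csimple_mem[OF F \<omega>, of 0]] by (simp add: G_def)
      then show ?thesis
        by (simp add: ennreal_mult')
    next
      case False
      then obtain n where n: "vnorm Y (F 0 \<omega>) \<le> 5 * vnorm Y (cdiff (F n \<omega>) (F 0 \<omega>))"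
        using \<omega> by (auto simp: \<Omega>_def not_le intro: less_imp_le)
      have \<rho>_nonneg: "0 \<le> \<rho> i \<omega>" for i
        unfolding \<rho>_def by (intro norm_nonneg cdiff_mem csimple_mem[OF F \<omega>])
      have "vnorm Y (cdiff (F n \<omega>) (F 0 \<omega>)) \<le> (\<Sum>i<n. \<rho> i \<omega>)"
      proof (induction n)
        case 0
        have "cdiff (F 0 \<omega>) (F 0 \<omega>) = vzero Y"
          by (simp add: cdiff_def C_space_ops fun_eq_iff)
        then show ?case
          by (simp add: norm_zero)
      next
        case (Suc n)
        then show ?case
          using norm_triangle[OF csimple_mem[OF F \<omega>, of "Suc n"] csimple_mem[OF F \<omega>, of n]
              csimple_mem[OF F \<omega>, of 0]] by (simp add: \<rho>_def)
      qed
      with n have "ennreal (vnorm Y (F 0 \<omega>)) \<le> ennreal (5 * (\<Sum>i<n. \<rho> i \<omega>))"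
        by (intro ennreal_leI) linarith
      also have "\<dots> = 5 * (\<Sum>i<n. ennreal (\<rho> i \<omega>))"
        using \<rho>_nonneg by (simp add: ennreal_mult' sum_ennreal)
      also have "\<dots> \<le> 5 * (\<Sum>n. ennreal (\<rho> n \<omega>))"
        by (intro mult_left_mono sum_le_suminf) auto
      finally show ?thesis
        by (simp add: add_increasing)
    qed
    have [measurable]: "(\<lambda>\<omega>. vnorm Y (G \<omega>)) \<in> borel_measurable M" "\<rho> n \<in> borel_measurable M" for n
      unfolding \<rho>_def by (intro norm_measurable csimple_diff F G)+
    have "ennreal (vnorm V (t 0)) = (\<integral>\<^sup>+\<omega>. ennreal (vnorm Y (F 0 \<omega>)) \<partial>M)"
      by (simp add: nn_integral_csimple F t_def)
    also have "\<dots> \<le> (\<integral>\<^sup>+\<omega>. (5 * ennreal (vnorm Y (G \<omega>)) + 5 * (\<Sum>n. ennreal (\<rho> n \<omega>))) \<partial>M)"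
      by (intro nn_integral_mono pointwise)
    also have "\<dots> = 5 * (\<integral>\<^sup>+\<omega>. ennreal (vnorm Y (G \<omega>)) \<partial>M) + 5 * (\<integral>\<^sup>+\<omega>. (\<Sum>n. ennreal (\<rho> n \<omega>)) \<partial>M)"
      by (simp add: nn_integral_add nn_integral_cmult)
    also have "\<dots> \<le> 5 * ennreal (vnorm V v) + 5 * ennreal \<epsilon>"
      by (intro add_mono mult_left_mono \<rho>_sum) (simp_all add: nn_integral_csimple G v_def)
    also have "\<dots> = ennreal (5 * vnorm V v + 5 * \<epsilon>)"
      using \<epsilon> ten.alg.norm_nonneg[OF v] by (simp add: ennreal_mult')
    finally show ?thesis .
  qed
  then have "vnorm V (t 0) \<le> 5 * vnorm V v + 5 * \<epsilon>"
    by (subst (asm) ennreal_le_iff) (use \<epsilon> ten.alg.norm_nonneg[OF v] in auto)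
  moreover have "l \<le> vnorm V (t 0) + \<delta> 0"
    using L_approx[OF ten.alg.zero_mem, of 0] L_0 by simp
  moreover have "\<delta> 0 \<le> \<epsilon>"
    using \<epsilon> by (simp add: \<delta>_def)
  ultimately have v_large: "1 / 10 * l \<le> vnorm V v"
    by (simp add: \<epsilon>_def)
  \<comment> \<open>For a simple tensor this list costs exactly its norm, so the bounds on the norm
    of \<open>v\<close> are bounds on the weight.\<close>
  obtain zs where zs: "set zs \<subseteq> vecs X \<times> vecs Y" "tensor_of X Y zs = v" "tensor_weight X Y zs = vnorm V v"
    using simple_tensor_list[OF G] norm_simple_tensor[OF G] unfolding v_def by metis
  with L_v v_large show ?thesis
    unfolding L_def l_def by (intro exI[of _ zs]) simp
qed

end

theorem corollary5p10:
  fixes M :: "'w measure" and K :: "'k topology"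
  assumes "compact_space K" and "Hausdorff_space K" and "totally_disconnected_space K"
  shows "NA_proj (L1_space M) (C_space K) = vecs (proj_tensor (L1_space M) (C_space K))"
proof -
  interpret L1_tensor_stone K M
    by unfold_locales (use assms in auto)
  show ?thesis
    by (rule ten.NA_proj_eqI[where c = "1 / 10"]) (use exists_split in auto)
qed

end
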